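(* Under the setting described in the context, the map $G:\Theta_T\to\Theta_T$ has a unique fixed point $y_C\in\Theta_T$, i.e. there is a unique $y_C\in\Theta_T$ with $y_C=G(y_C)$.
   Context: Fix $T>0$. Let $W\subset C^1([0,1]\times[0,T];[0,\infty))$ be a set of non-negative $C^1$ functions $w(y,t)$, with Borel $\sigma$-algebra $\mathcal{B}(W)$ from the supremum norm $\|w\|=\sup_{(y,t)\in[0,1]\times[0,T]}|w(y,t)|$. Let $\lambda$ be a Borel probability measure on $W$ with $M_W:=\int_W\|w\|\lambda(dw)<\infty$ and $C_W:=\sup_{w\in W}\|\partial w/\partial y\|<\infty$ ($\partial/\partial y$ = derivative in the first variable). Let $\mu_0(dw\times dz)=\sigma(w,z)\lambda(dw)dz$ be a probability measure on $W\times[0,1]$ with $\int_W\sigma(w,y)\lambda(dw)=1$ for all $y$ and $\int_0^1\sigma(w,z)dz=1$ for all $w$. Let $\Gamma_b=\{(0,s):0\le s\le T\}$, $\Gamma_i=\{(z,0):0\le z\le1\}$, $\Gamma=\Gamma_b\cup\Gamma_i$, $\Gamma_t=\Gamma_i\cup\{(0,s):0\le s\le t\}$, $\Delta_T=\{(\gamma,t)\in\Gamma\times[0,T]:\gamma\in\Gamma_t\}$. Totally order $\Gamma$ by: for $s\le t$ and $z\le y$, $(0,T)\succeq(0,t)\succeq(0,s)\succeq(0,0)\succeq(z,0)\succeq(y,0)\succeq(1,0)$. The set of flows $\Theta_T$ consists of all continuous $\theta:\Delta_T\to[0,1]$ with $\theta((y_0,t_0),t_0)=y_0$ for $(y_0,t_0)\in\Gamma$,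 such that for each $t$ the map $\theta(\cdot,t):\Gamma_t\to[0,1]$ is surjective and non-increasing with respect to $\succeq$, and for each $\gamma$, $\theta(\gamma,t)$ is non-decreasing in $t$. A point process with intensity $\omega$ (a non-negative bounded continuous function of $0\le s\le t\le T$) is a non-decreasing right-continuous $\mathbb{Z}_{\ge0}$-valued process $N$ with $N(0)=0$ such that, with $\tau_0=0$, $\tau_k=\inf\{t:N(t)\ge k\}$, $\mathcal{F}_t=\sigma[N(s),s\le t]$, one has $\mathbb{P}(t<\tau_k\mid\mathcal{F}_{\tau_{k-1}})=\exp(-\int_{\tau_{k-1}}^t\omega(\tau_{k-1},u)du)$ on $\{t\ge\tau_{k-1}\}$ for $k\ge1$. For $\theta\in\Theta_T$, $w\in W$, $z\in[0,1)$ let $\omega_{\theta,w,z}(0,t)=w(\theta((z,0),t),t)$ and $\omega_{\theta,w,z}(s,t)=w(\theta((0,s),t),t)$ for $s>0$, and let $N_{\theta,w,z}$ be a point process with intensity $\omega_{\theta,w,z}$. The map $G$ on $\Theta_T$ is defined by \[G(\theta)(\gamma,t)=1-\int_{W\times[y_0,1)}\mathbb{P}\bigl(N_{\theta,w,z}(t)=N_{\theta,w,z}(t_0)\bigr)\,\mu_0(dw\times dz),\quad\gamma=(y_0,t_0)\in\Gamma,\ (\gamma,t)\in\Delta_T,\] and it maps $\Theta_T$ into $\Theta_T$. *)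

theory Defs
  imports "HOL-Probability.Probability"
begin

type_synonym rfun = "real \<times> real \<Rightarrow> real"

definition rect :: "real \<Rightarrow> (real \<times> real) set" where
  "rect T = {0..1} \<times> {0..T}"

definition C1_rect :: "real \<Rightarrow> rfun \<Rightarrow> bool" where
  "C1_rect T w \<longleftrightarrow> (\<exists>D1 D2. continuous_on (rect T) D1 \<and> continuous_on (rect T) D2 \<and>
     (\<forall>p\<in>rect T. (w has_derivative (\<lambda>(h,k). D1 p * h + D2 p * k)) (at p within rect T)))"

definition partial_y :: "rfun \<Rightarrow> real \<times> real \<Rightarrow> real" where
  "partial_y w p = vector_derivative (\<lambda>y. w (y, snd p)) (at (fst p) within {0..1})"

definition supnorm :: "real \<Rightarrow> rfun \<Rightarrow> real" where
  "supnorm T w = (SUP p\<in>rect T. \<bar>w p\<bar>)"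

definition sup_open :: "real \<Rightarrow> rfun set \<Rightarrow> rfun set \<Rightarrow> bool" where
  "sup_open T W U \<longleftrightarrow> U \<subseteq> W \<and>
     (\<forall>u\<in>U. \<exists>e>0. \<forall>v\<in>W. supnorm T (\<lambda>p. u p - v p) < e \<longrightarrow> v \<in> U)"

definition borel_supnorm :: "real \<Rightarrow> rfun set \<Rightarrow> rfun set set" where
  "borel_supnorm T W = sigma_sets W (Collect (sup_open T W))"

definition mu0 :: "rfun measure \<Rightarrow> (rfun \<Rightarrow> real \<Rightarrow> real) \<Rightarrow> (rfun \<times> real) measure" where
  "mu0 lam \<sigma> = density (lam \<Otimes>\<^sub>M restrict_space lborel {0..1}) (\<lambda>(w,z). ennreal (\<sigma> w z))"

definition Gamma_b :: "real \<Rightarrow> (real \<times> real) set" where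
  "Gamma_b T = {(0, s) | s. 0 \<le> s \<and> s \<le> T}"

definition Gamma_i :: "(real \<times> real) set" where
  "Gamma_i = {(z, 0) | z. 0 \<le> z \<and> z \<le> 1}"

definition Gamma :: "real \<Rightarrow> (real \<times> real) set" where
  "Gamma T = Gamma_b T \<union> Gamma_i"

definition Gamma_t :: "real \<Rightarrow> (real \<times> real) set" where
  "Gamma_t t = Gamma_i \<union> {(0, s) | s. 0 \<le> s \<and> s \<le> t}"

definition Delta :: "real \<Rightarrow> ((real \<times> real) \<times> real) set" where
  "Delta T = {(\<gamma>, t). \<gamma> \<in> Gamma T \<and> 0 \<le> t \<and> t \<le> T \<and> \<gamma> \<in> Gamma_t t}"

text \<open>The total order on Gamma: (0,T) >= (0,t) >= (0,s) >= (0,0) >= (z,0) >= (y,0) >= (1,0)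
  for s <= t and z <= y.\<close>
definition gsucceq :: "real \<Rightarrow> real \<times> real \<Rightarrow> real \<times> real \<Rightarrow> bool" where
  "gsucceq T \<gamma> \<gamma>' \<longleftrightarrow> \<gamma> \<in> Gamma T \<and> \<gamma>' \<in> Gamma T \<and>
     ((fst \<gamma> = 0 \<and> fst \<gamma>' = 0 \<and> snd \<gamma>' \<le> snd \<gamma>) \<or>
      (fst \<gamma> = 0 \<and> snd \<gamma>' = 0) \<or>
      (snd \<gamma> = 0 \<and> snd \<gamma>' = 0 \<and> fst \<gamma> \<le> fst \<gamma>'))"

text \<open>Flows theta(gamma,t), as functions of gamma and t; values outside Delta_T are fixed to 0
  (extensionality) so that flows are determined by their values on Delta_T.\<close>
definition Theta :: "real \<Rightarrow> (real \<times> real \<Rightarrow> real \<Rightarrow> real) set" where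
  "Theta T = {\<theta>.
     continuous_on (Delta T) (\<lambda>(\<gamma>, t). \<theta> \<gamma> t) \<and>
     (\<forall>\<gamma> t. (\<gamma>, t) \<in> Delta T \<longrightarrow> \<theta> \<gamma> t \<in> {0..1}) \<and>
     (\<forall>y0 t0. (y0, t0) \<in> Gamma T \<longrightarrow> \<theta> (y0, t0) t0 = y0) \<and>
     (\<forall>t\<in>{0..T}. (\<lambda>\<gamma>. \<theta> \<gamma> t) ` Gamma_t t = {0..1}) \<and>
     (\<forall>t\<in>{0..T}. \<forall>\<gamma>\<in>Gamma_t t. \<forall>\<gamma>'\<in>Gamma_t t. gsucceq T \<gamma> \<gamma>' \<longrightarrow> \<theta> \<gamma> t \<le> \<theta> \<gamma>' t) \<and>
     (\<forall>\<gamma> t t'. (\<gamma>, t) \<in> Delta T \<longrightarrow> (\<gamma>, t') \<in> Delta T \<longrightarrow> t \<le> t' \<longrightarrow> \<theta> \<gamma> t \<le> \<theta> \<gamma> t') \<and>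
     (\<forall>\<gamma> t. (\<gamma>, t) \<notin> Delta T \<longrightarrow> \<theta> \<gamma> t = 0)}"

definition nat_filtration :: "'a measure \<Rightarrow> ('a \<Rightarrow> real \<Rightarrow> nat) \<Rightarrow> real \<Rightarrow> 'a set set" where
  "nat_filtration M N t =
     sigma_sets (space M) {(\<lambda>x. N x s) -` A \<inter> space M | s A. 0 \<le> s \<and> s \<le> t}"

definition jump_time :: "real \<Rightarrow> ('a \<Rightarrow> real \<Rightarrow> nat) \<Rightarrow> nat \<Rightarrow> 'a \<Rightarrow> ereal" where
  "jump_time T N k x =
     (if \<exists>t\<in>{0..T}. k \<le> N x t then ereal (Inf {t\<in>{0..T}. k \<le> N x t}) else \<infinity>)"

definition stopped_sigma :: "real \<Rightarrow> 'a measure \<Rightarrow> ('a \<Rightarrow> real \<Rightarrow> nat) \<Rightarrow> ('a \<Rightarrow> ereal) \<Rightarrow> 'a set set" where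
  "stopped_sigma T M N \<tau> = {A \<in> nat_filtration M N T.
     \<forall>t\<in>{0..T}. A \<inter> {x \<in> space M. \<tau> x \<le> ereal t} \<in> nat_filtration M N t}"

text \<open>N is a point process with intensity om: the conditional probability
  P(t < tau_k | F_{tau_{k-1}}) = exp(-int_{tau_{k-1}}^t om(tau_{k-1},u) du) on {t >= tau_{k-1}},
  written out via the defining property of conditional expectation.\<close>
definition point_process ::
  "real \<Rightarrow> 'a measure \<Rightarrow> ('a \<Rightarrow> real \<Rightarrow> nat) \<Rightarrow> (real \<Rightarrow> real \<Rightarrow> real) \<Rightarrow> bool" where
  "point_process T M N om \<longleftrightarrow>
     prob_space M \<and>
     (\<forall>t\<in>{0..T}. (\<lambda>x. N x t) \<in> measurable M (count_space UNIV)) \<and>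
     (\<forall>x\<in>space M. N x 0 = 0 \<and> mono_on {0..T} (N x) \<and>
        (\<forall>t\<in>{0..T}. continuous (at t within {t..T}) (\<lambda>s. real (N x s)))) \<and>
     (\<forall>k\<ge>1. \<forall>t\<in>{0..T}. \<forall>A\<in>stopped_sigma T M N (jump_time T N (k - 1)).
        measure M {x \<in> A. jump_time T N (k - 1) x \<le> ereal t \<and> ereal t < jump_time T N k x} =
        (\<integral>x. indicator {x \<in> A. jump_time T N (k - 1) x \<le> ereal t} x *
              exp (- (LBINT u:{real_of_ereal (jump_time T N (k - 1) x)..t}.
                        om (real_of_ereal (jump_time T N (k - 1) x)) u)) \<partial>M))"

definition omega :: "(real \<times> real \<Rightarrow> real \<Rightarrow> real) \<Rightarrow> rfun \<Rightarrow> real \<Rightarrow> real \<Rightarrow> real \<Rightarrow> real" where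
  "omega \<theta> w z s t = (if s = 0 then w (\<theta> (z, 0) t, t) else w (\<theta> (0, s) t, t))"

definition Gmap ::
  "real \<Rightarrow> rfun measure \<Rightarrow> (rfun \<Rightarrow> real \<Rightarrow> real)
   \<Rightarrow> ((real \<times> real \<Rightarrow> real \<Rightarrow> real) \<Rightarrow> rfun \<Rightarrow> real \<Rightarrow> 'a measure)
   \<Rightarrow> ((real \<times> real \<Rightarrow> real \<Rightarrow> real) \<Rightarrow> rfun \<Rightarrow> real \<Rightarrow> 'a \<Rightarrow> real \<Rightarrow> nat)
   \<Rightarrow> (real \<times> real \<Rightarrow> real \<Rightarrow> real) \<Rightarrow> (real \<times> real \<Rightarrow> real \<Rightarrow> real)" where
  "Gmap T lam \<sigma> \<Omega> N \<theta> = (\<lambda>\<gamma> t.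
     if (\<gamma>, t) \<in> Delta T then
       1 - set_lebesgue_integral (mu0 lam \<sigma>) (UNIV \<times> {fst \<gamma>..<1})
             (\<lambda>(w, z). measure (\<Omega> \<theta> w z)
                {x \<in> space (\<Omega> \<theta> w z). N \<theta> w z x t = N \<theta> w z x (snd \<gamma>)})
     else 0)"

end

(* Condition on the last jump: given a jump at time s, the law of the next jump has density
   om(s,u) exp(-int_s^u om(s,.)), so P(N(t) = N(t0)) is the limit at s = 0 of the iterates of the
   operator J on functions on [0,t] given by
     (J f)(s) = 1[s <= t0] exp(-int_s^t om(s,.)) + int_s^t om(s,u) exp(-int_s^u om(s,.)) f(u) du.
   Weighting the difference of two intensities by the survival probability and inducting on the
   iterates bounds the difference of two such probabilities by 2 int_0^t |om - om'| with a constant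
   that does not involve the size of the intensities, which matters because only the first moment of
   the sup norm of w is finite.  Since w is C-Lipschitz in y uniformly over W, G is a contraction
   for the weighted distance sup exp(-(4C+1)t) |theta - theta'|, and Picard iteration converges.
   The same estimate makes the probability continuous in (w,z), hence jointly measurable. *)
theory Submission
  imports Defs
begin

section \<open>Survival probabilities\<close>

text \<open>The processes attached to different flows, functions and positions may live on unrelated
  probability spaces, so no coupling is available and every comparison must pass through laws. The
  definition of a point process prescribes only conditional survival probabilities. Tested on the
  events \<open>k \<le> N x a\<close> it yields the distribution functions of the successive jump
  times, and uniqueness of a measure with given distribution function upgrades this to integrals of
  Borel functions with values in [0,1], which is what iterating J requires. Started from the zero
  function, the n-th iterate at 0 is exactly the sum of P(N(t0) = N(t) = k) over k < n, so its
  convergence needs no tail estimate.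

  The two normalisations of \<sigma> say that the marginals of \<open>mu0 lam \<sigma>\<close> are
  \<open>lam\<close> and Lebesgue measure on [0,1]. The first turns the moment of the sup norm into
  a Lipschitz bound for G(\<theta>) in time; the second gives the starting values and the Lipschitz
  bound in the starting position. The exponent 4C + 1 answers the comparison constant 2: the
  weighted contraction factor is at most 2C / (4C + 1) < 1/2.\<close>

lemma set_integrable_continuous:
  fixes f :: "real \<Rightarrow> real"
  assumes "continuous_on {a..b} f"
  shows "set_integrable lborel {a..b} f"
  using borel_integrable_compact[OF compact_Icc assms] by (simp add: set_integrable_def indicator_scaleR_eq_if)

lemma set_integral_FTC:
  fixes F f :: "real \<Rightarrow> real"
  assumes "a \<le> b" "continuous_on {a..b} f"
    and "\<And>u. u \<in> {a..b} \<Longrightarrow> (F has_real_derivative f u) (at u within {a..b})"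
  shows "(LBINT u:{a..b}. f u) = F b - F a"
  unfolding set_lebesgue_integral_def
  using integral_FTC_atLeastAtMost[OF assms(1) _ assms(2), of F] assms(3)
  by (simp add: has_real_derivative_iff_has_vector_derivative)

lemma set_integral_deriv:
  fixes f :: "real \<Rightarrow> real"
  assumes "continuous_on {a..b} f" "u \<in> {a..b}"
  shows "((\<lambda>u. LBINT v:{a..u}. f v) has_real_derivative f u) (at u within {a..b})"
proof -
  have eq: "(LBINT v:{a..u}. f v) = integral {a..u} f" if "u \<in> {a..b}" for u
    using that assms(1)
    by (intro set_borel_integral_eq_integral set_integrable_continuous) (auto intro: continuous_on_subset)
  have "((\<lambda>u. integral {a..u} f) has_real_derivative f u) (at u within {a..b})"
    using integral_has_real_derivative[OF assms] .
  then show ?thesis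
    by (rule has_field_derivative_transform_within[where d=1]) (use assms eq in auto)
qed

definition surv :: "(real \<Rightarrow> real) \<Rightarrow> real \<Rightarrow> real \<Rightarrow> real" where
  "surv a s t = exp (- (LBINT u:{s..t}. a u))"

lemma surv_pos [simp]: "0 < surv a s t"
  by (simp add: surv_def)

lemma surv_nonneg [simp]: "0 \<le> surv a s t"
  by (simp add: surv_def)

lemma surv_nonzero [simp]: "surv a s t \<noteq> 0"
  by (simp add: surv_def)

lemma surv_self [simp]: "surv a s s = 1"
proof -
  have "(LBINT u:{s..s}. a u) = 0"
    unfolding set_lebesgue_integral_def
    by (rule integral_eq_zero_AE, rule AE_mp[OF AE_lborel_singleton[of s]]) (auto intro!: AE_I2)
  then show ?thesis by (simp add: surv_def)
qed

lemma surv_le_1: "(\<And>u. u \<in> {s..t} \<Longrightarrow> 0 \<le> a u) \<Longrightarrow> surv a s t \<le> 1"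
  unfolding surv_def set_lebesgue_integral_def
  by (auto intro!: Bochner_Integration.integral_nonneg simp: indicator_def)

lemma surv_deriv:
  assumes "continuous_on {s..t} a" "u \<in> {s..t}"
  shows "(surv a s has_real_derivative - a u * surv a s u) (at u within {s..t})"
proof -
  have "((\<lambda>t. exp (- (LBINT u:{s..t}. a u))) has_real_derivative exp (- (LBINT v:{s..u}. a v)) * - a u) (at u within {s..t})"
    using DERIV_chain2[OF DERIV_exp DERIV_minus[OF set_integral_deriv[OF assms]]] .
  then show ?thesis by (simp add: surv_def[abs_def] mult.commute)
qed

lemma surv_continuous:
  assumes "continuous_on {s..t} a"
  shows "continuous_on {s..t} (surv a s)"
  by (rule DERIV_continuous_on[OF surv_deriv[OF assms]])

text \<open>The integrand is minus the derivative of \<open>surv a s\<close>: it is the density of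
  the next jump time, and the mass it lacks is the probability that no jump occurs before
  \<open>t\<close>.\<close>

lemma surv_density_integral:
  assumes "continuous_on {s..t} a" "s \<le> t"
  shows "(LBINT u:{s..t}. a u * surv a s u) = 1 - surv a s t"
proof -
  have c: "continuous_on {s..t} (\<lambda>u. a u * surv a s u)"
    by (intro continuous_on_mult assms surv_continuous)
  have d: "((\<lambda>u. - surv a s u) has_real_derivative a u * surv a s u) (at u within {s..t})" if "u \<in> {s..t}" for u
    using DERIV_minus[OF surv_deriv[OF assms(1) that]] by simp
  show ?thesis using set_integral_FTC[OF assms(2) c d] by simp
qed

text \<open>Survival is multiplicative over adjacent intervals, and the second factor is bounded
  below by exp(-x) \<ge> 1 - x. This is the source of all Lipschitz bounds in time; here the bound
  on the intensity does enter.\<close>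

lemma surv_extend_ge:
  assumes "continuous_on {r..t} a" "r \<le> s" "s \<le> t"
    and "\<And>u. u \<in> {r..t} \<Longrightarrow> 0 \<le> a u" "\<And>u. u \<in> {r..t} \<Longrightarrow> a u \<le> B"
  shows "surv a r s * (1 - B * (t - s)) \<le> surv a r t"
proof -
  have c: "continuous_on {s..t} a" "continuous_on {r..s} a"
    using assms by (auto intro: continuous_on_subset)
  have "(LBINT u:{r..t}. a u) = (LBINT u:{r..s}. a u) + (LBINT u:{s..t}. a u)"
    using assms c
    by (simp add: set_borel_integral_eq_integral set_integrable_continuous
        Henstock_Kurzweil_Integration.integral_combine integrable_continuous_real)
  then have eq: "surv a r t = surv a r s * surv a s t"
    by (simp add: surv_def exp_add[symmetric])
  have "(LBINT u:{s..t}. a u) \<le> (LBINT u:{s..t}. B)"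
    using assms c by (intro set_integral_mono set_integrable_continuous) auto
  then have "(LBINT u:{s..t}. a u) \<le> B * (t - s)"
    using assms by (simp add: set_lebesgue_integral_def mult.commute)
  then have "1 - B * (t - s) \<le> surv a s t"
    unfolding surv_def using exp_ge_add_one_self[of "- (LBINT u:{s..t}. a u)"] by linarith
  with eq show ?thesis
    by (auto intro: mult_left_mono)
qed

text \<open>The function \<open>Y\<close> of the proof solves \<open>Y' = \<bar>a - b\<bar> surv a - b Y\<close>, \<open>Y s = 0\<close>, and dominates
  \<open>\<bar>surv a - surv b\<bar>\<close>; integrating the equation absorbs the term \<open>b \<bar>surv a - surv b\<bar>\<close> without
  any bound on \<open>b\<close>.\<close>
lemma surv_density_diff:
  assumes a: "continuous_on {s..t} a" and b: "continuous_on {s..t} b" and st: "s \<le> t"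
    and b0: "\<And>u. u \<in> {s..t} \<Longrightarrow> 0 \<le> b u"
  shows "(LBINT u:{s..t}. \<bar>a u * surv a s u - b u * surv b s u\<bar>) + \<bar>surv a s t - surv b s t\<bar>
         \<le> 2 * (LBINT u:{s..t}. \<bar>a u - b u\<bar> * surv a s u)"
proof -
  let ?A = "surv a s" and ?B = "surv b s"
  define I where "I u = (LBINT v:{s..u}. \<bar>a v - b v\<bar> * ?A v / ?B v)" for u
  define Y where "Y u = ?B u * I u" for u
  note cont = a b surv_continuous[OF a] surv_continuous[OF b]
  have cI: "continuous_on {s..t} (\<lambda>v. \<bar>a v - b v\<bar> * ?A v / ?B v)"
    by (intro continuous_intros cont) auto
  have dI: "(I has_real_derivative \<bar>a u - b u\<bar> * ?A u / ?B u) (at u within {s..t})" if "u \<in> {s..t}" for u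
    unfolding I_def using set_integral_deriv[OF cI that] .
  have cIc: "continuous_on {s..t} I"
    by (rule DERIV_continuous_on[OF dI])
  have cY: "continuous_on {s..t} Y"
    unfolding Y_def by (intro continuous_intros cont cIc)
  have dY: "(Y has_real_derivative \<bar>a u - b u\<bar> * ?A u - b u * Y u) (at u within {s..t})" if "u \<in> {s..t}" for u
    unfolding Y_def
    using DERIV_mult[OF surv_deriv[OF b that] dI[OF that]] by (simp add: field_simps)
  have D: "\<bar>?A u - ?B u\<bar> \<le> Y u" if u: "u \<in> {s..t}" for u
  proof -
    have sub: "{s..u} \<subseteq> {s..t}" using u by auto
    have cc: "continuous_on {s..u} (\<lambda>v. - ((a v - b v) * ?A v / ?B v))"
      by (rule continuous_on_subset[OF _ sub]) (intro continuous_intros cont, auto)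
    \<comment> \<open>In the logarithmic derivative of the ratio \<open>?A / ?B\<close> the
      intensities occur only through \<open>a - b\<close>, so the ratio stays close to 1 however
      large \<open>b\<close> is.\<close>
    have "(LBINT v:{s..u}. - ((a v - b v) * ?A v / ?B v)) = ?A u / ?B u - ?A s / ?B s"
    proof (rule set_integral_FTC[OF _ cc])
      show "s \<le> u" using u by auto
      fix v assume v: "v \<in> {s..u}"
      then have vt: "v \<in> {s..t}" using sub by auto
      show "((\<lambda>u. ?A u / ?B u) has_real_derivative - ((a v - b v) * ?A v / ?B v)) (at v within {s..u})"
        by (rule DERIV_cong[OF DERIV_divide[OF has_field_derivative_subset[OF surv_deriv[OF a vt] sub]
             has_field_derivative_subset[OF surv_deriv[OF b vt] sub]]])
          (simp_all add: field_simps)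
    qed
    then have "?A u / ?B u - 1 = (LBINT v:{s..u}. - ((a v - b v) * ?A v / ?B v))" by simp
    also have "\<bar>\<dots>\<bar> \<le> I u"
    proof -
      have "norm (LBINT v:{s..u}. - ((a v - b v) * ?A v / ?B v)) \<le>
            (LBINT v:{s..u}. norm (- ((a v - b v) * ?A v / ?B v)))"
        by (rule set_integral_norm_bound[OF set_integrable_continuous[OF cc]])
      then show ?thesis by (simp add: I_def abs_mult)
    qed
    finally have "\<bar>?A u / ?B u - 1\<bar> \<le> I u" .
    then have "?B u * \<bar>?A u / ?B u - 1\<bar> \<le> Y u" by (simp add: Y_def)
    moreover have "?B u * \<bar>?A u / ?B u - 1\<bar> = \<bar>?A u - ?B u\<bar>"
    proof -
      have "?B u * \<bar>?A u / ?B u - 1\<bar> = \<bar>?B u * (?A u / ?B u - 1)\<bar>"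
        by (simp add: abs_mult)
      also have "?B u * (?A u / ?B u - 1) = ?A u - ?B u" by (simp add: right_diff_distrib)
      finally show ?thesis .
    qed
    ultimately show ?thesis by simp
  qed
  have "I s = 0" unfolding I_def set_lebesgue_integral_def
    by (rule integral_eq_zero_AE, rule AE_mp[OF AE_lborel_singleton[of s]]) (auto intro!: AE_I2)
  then have Ys: "Y s = 0" by (simp add: Y_def)
  have i1: "set_integrable lborel {s..t} (\<lambda>u. \<bar>a u - b u\<bar> * ?A u)"
    and i2: "set_integrable lborel {s..t} (\<lambda>u. b u * Y u)"
    by (intro set_integrable_continuous continuous_intros cont cY)+
  have FY: "(LBINT u:{s..t}. \<bar>a u - b u\<bar> * ?A u - b u * Y u) = Y t - Y s"
    by (intro set_integral_FTC st dY continuous_intros cont cY) auto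
  have "(LBINT u:{s..t}. \<bar>a u * ?A u - b u * ?B u\<bar>) \<le> (LBINT u:{s..t}. \<bar>a u - b u\<bar> * ?A u + b u * Y u)"
  proof (intro set_integral_mono set_integrable_continuous continuous_intros cont cY)
    fix u assume u: "u \<in> {s..t}"
    have "a u * ?A u - b u * ?B u = (a u - b u) * ?A u + b u * (?A u - ?B u)"
      by (simp add: algebra_simps)
    also have "\<bar>\<dots>\<bar> \<le> \<bar>a u - b u\<bar> * ?A u + b u * \<bar>?A u - ?B u\<bar>"
      using b0[OF u] by (intro order_trans[OF abs_triangle_ineq]) (simp add: abs_mult)
    also have "\<dots> \<le> \<bar>a u - b u\<bar> * ?A u + b u * Y u"
      using D[OF u] b0[OF u] by (simp add: mult_left_mono)
    finally show "\<bar>a u * ?A u - b u * ?B u\<bar> \<le> \<bar>a u - b u\<bar> * ?A u + b u * Y u" .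
  qed
  moreover have "\<bar>?A t - ?B t\<bar> \<le> Y t" using D st by auto
  \<comment> \<open>By \<open>FY\<close> the integral of \<open>b u * Y u\<close> plus the end value
    \<open>Y t\<close> equals the integral of \<open>\<bar>a u - b u\<bar> * ?A u\<close>. This is
    the second copy that makes the factor 2, and it also pays for the end term.\<close>
  ultimately show ?thesis
    using FY Ys set_integral_add(2)[OF i1 i2] set_integral_diff(2)[OF i1 i2] by simp
qed

section \<open>The one-jump operator\<close>

lemma set_integrable_bounded:
  fixes g :: "real \<Rightarrow> real"
  assumes "g \<in> borel_measurable borel" "\<And>u. u \<in> {s..t} \<Longrightarrow> \<bar>g u\<bar> \<le> B"
  shows "set_integrable lborel {s..t} g"
  unfolding set_integrable_def
  by (rule integrableI_bounded_set_indicator[where B=B])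
    (use assms in \<open>auto simp: emeasure_lborel_Icc_eq\<close>)

text \<open>Measurability, sign and bound are global so that integrals depending on \<open>s\<close>
  are measurable without side conditions; continuity is confined to the triangle where the
  fundamental theorem is applied. \<open>B\<close> serves integrability and time regularity and
  stays out of the comparison of two intensities.\<close>

locale intensity =
  fixes T B :: real and om :: "real \<Rightarrow> real \<Rightarrow> real"
  assumes om_measurable [measurable]: "case_prod om \<in> borel_measurable (borel \<Otimes>\<^sub>M borel)"
    and om_nonneg: "\<And>s u. 0 \<le> om s u"
    and om_le: "\<And>s u. om s u \<le> B"
    and om_cont: "\<And>s. s \<in> {0..T} \<Longrightarrow> continuous_on {s..T} (om s)"

text \<open>If \<open>f u\<close> is the probability that no jump falls into \<open>(t0, t]\<close> given a jump at time \<open>u\<close>,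
  then the same probability given a jump at time \<open>s\<close> is \<open>jump_op om t0 t f s\<close>.\<close>
definition jump_op :: "(real \<Rightarrow> real \<Rightarrow> real) \<Rightarrow> real \<Rightarrow> real \<Rightarrow> (real \<Rightarrow> real) \<Rightarrow> real \<Rightarrow> real" where
  "jump_op om t0 t f s = (if s \<in> {0..t} then indicator {..t0} s * surv (om s) s t
     + (LBINT u:{s..t}. om s u * surv (om s) s u * f u) else 0)"

context intensity
begin

lemma om_cont_sub: "0 \<le> s \<Longrightarrow> t \<le> T \<Longrightarrow> continuous_on {s..t} (om s)"
  by (cases "s \<le> T") (auto intro: continuous_on_subset[OF om_cont])

lemma om_measurable_snd [measurable]: "om s \<in> borel_measurable borel"
  using measurable_compose[OF measurable_Pair1' om_measurable, of s] by simp

lemma surv_measurable [measurable]: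
  "(\<lambda>(s, u). surv (om s) s u) \<in> borel_measurable (borel \<Otimes>\<^sub>M borel)"
proof -
  have "(\<lambda>p. \<integral>v. (if fst p \<le> v \<and> v \<le> snd p then om (fst p) v else 0) \<partial>lborel)
        \<in> borel_measurable (borel \<Otimes>\<^sub>M borel)"
    by measurable
  moreover have "indicator {s..u} v *\<^sub>R om s v = (if s \<le> v \<and> v \<le> u then om s v else 0)" for s u v
    by auto
  ultimately show ?thesis
    by (simp add: surv_def[abs_def] set_lebesgue_integral_def case_prod_beta')
qed

lemma surv_measurable_snd [measurable]: "surv (om s) s \<in> borel_measurable borel"
  using measurable_compose[OF measurable_Pair1' surv_measurable, of s] by simp

lemma surv_om_le_1: "surv (om s) s t \<le> 1"
  by (rule surv_le_1) (rule om_nonneg)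

lemma B_nonneg: "0 \<le> B"
  using order_trans[OF om_nonneg om_le] .

lemma density_bound: "om s u * surv (om s) s u \<le> B"
  using mult_mono[OF om_le[of s u] surv_om_le_1[of s u] B_nonneg] by simp

lemma density_integrable:
  assumes [measurable]: "f \<in> borel_measurable borel" and f: "\<And>u. u \<in> {s..t} \<Longrightarrow> \<bar>f u\<bar> \<le> C"
  shows "set_integrable lborel {s..t} (\<lambda>u. om s u * surv (om s) s u * f u)"
proof (rule set_integrable_bounded)
  show "(\<lambda>u. om s u * surv (om s) s u * f u) \<in> borel_measurable borel"
    by measurable
  fix u assume "u \<in> {s..t}"
  then show "\<bar>om s u * surv (om s) s u * f u\<bar> \<le> B * C"
    using mult_mono[OF density_bound[of s u] f B_nonneg] om_nonneg by (simp add: abs_mult)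
qed

lemma jump_op_measurable:
  assumes [measurable]: "f \<in> borel_measurable borel"
  shows "jump_op om t0 t f \<in> borel_measurable borel"
proof -
  have "(\<lambda>s. if 0 \<le> s \<and> s \<le> t then (if s \<le> t0 then surv (om s) s t else 0)
      + (\<integral>u. (if s \<le> u \<and> u \<le> t then om s u * surv (om s) s u * f u else 0) \<partial>lborel) else 0)
      \<in> borel_measurable borel"
    by measurable
  moreover have "jump_op om t0 t f = (\<lambda>s. if 0 \<le> s \<and> s \<le> t then (if s \<le> t0 then surv (om s) s t else 0)
      + (\<integral>u. (if s \<le> u \<and> u \<le> t then om s u * surv (om s) s u * f u else 0) \<partial>lborel) else 0)"
    by (auto simp: fun_eq_iff jump_op_def set_lebesgue_integral_def intro!: Bochner_Integration.integral_cong)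
  ultimately show ?thesis by simp
qed

text \<open>The jump density has total mass \<open>1 - surv (om s) s t\<close> on
  \<open>{s..t}\<close>, which leaves exactly room for the survival term.\<close>

lemma jump_op_range:
  assumes [measurable]: "f \<in> borel_measurable borel" and f: "\<And>u. f u \<in> {0..1}" and t: "t \<le> T"
  shows "jump_op om t0 t f s \<in> {0..1}"
proof (cases "s \<in> {0..t}")
  case True
  have i: "set_integrable lborel {s..t} (\<lambda>u. om s u * surv (om s) s u * f u)"
    using f by (intro density_integrable[where C=1]) auto
  have "(LBINT u:{s..t}. om s u * surv (om s) s u * f u) \<le> (LBINT u:{s..t}. om s u * surv (om s) s u)"
    using f om_nonneg True t
    by (intro set_integral_mono i set_integrable_continuous continuous_on_mult om_cont_sub surv_continuous)
       (auto intro!: mult_left_le)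
  also have "\<dots> = 1 - surv (om s) s t"
    using True t by (intro surv_density_integral om_cont_sub) auto
  finally have "(LBINT u:{s..t}. om s u * surv (om s) s u * f u) \<le> 1 - surv (om s) s t" .
  moreover have "0 \<le> (LBINT u:{s..t}. om s u * surv (om s) s u * f u)"
    unfolding set_lebesgue_integral_def using f om_nonneg
    by (intro Bochner_Integration.integral_nonneg) auto
  moreover have "0 \<le> indicator {..t0} s * surv (om s) s t" "indicator {..t0} s * surv (om s) s t \<le> surv (om s) s t"
    by (auto simp: indicator_def)
  moreover have "jump_op om t0 t f s = indicator {..t0} s * surv (om s) s t
     + (LBINT u:{s..t}. om s u * surv (om s) s u * f u)"
    using True by (simp add: jump_op_def)
  ultimately show ?thesis unfolding atLeastAtMost_iff by linarith
qed (auto simp: jump_op_def)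

lemma jump_op_iterate:
  assumes "t \<le> T"
  shows "(jump_op om t0 t ^^ n) (\<lambda>_. 0) \<in> borel_measurable borel"
    and "(jump_op om t0 t ^^ n) (\<lambda>_. 0) s \<in> {0..1}"
proof (induction n arbitrary: s)
  case (Suc n)
  { case 1 show ?case using jump_op_measurable[OF Suc(1)] by simp
  next case 2 show ?case using jump_op_range[OF Suc(1) Suc(2) assms] by simp }
qed auto

end

text \<open>The bound \<open>\<epsilon>\<close> reproduces itself because \<open>om (surv om) \<epsilon> + 2 D exp (\<beta> u) surv om\<close> is the
  derivative of \<open>- surv om \<epsilon>\<close> and \<open>\<epsilon> t = 0\<close>.\<close>
lemma jump_op_diff:
  assumes "intensity T B om" "intensity T B' om'"
    and \<beta>: "0 < \<beta>" and t: "t \<le> T"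
    and om: "\<And>s u. 0 \<le> s \<Longrightarrow> s \<le> u \<Longrightarrow> u \<le> t \<Longrightarrow> \<bar>om s u - om' s u\<bar> \<le> D * exp (\<beta> * u)"
    and f[measurable]: "f \<in> borel_measurable borel" "f' \<in> borel_measurable borel"
    and f01: "\<And>u. f u \<in> {0..1}" "\<And>u. f' u \<in> {0..1}"
    and ff': "\<And>u. u \<in> {0..t} \<Longrightarrow> \<bar>f u - f' u\<bar> \<le> 2 * D * (exp (\<beta> * t) - exp (\<beta> * u)) / \<beta>"
    and s: "s \<in> {0..t}"
  shows "\<bar>jump_op om t0 t f s - jump_op om' t0 t f' s\<bar> \<le> 2 * D * (exp (\<beta> * t) - exp (\<beta> * s)) / \<beta>"
proof -
  interpret a: intensity T B om by fact
  interpret b: intensity T B' om' by fact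
  let ?a = "om s" and ?b = "om' s" and ?A = "surv (om s) s" and ?B = "surv (om' s) s"
  define \<epsilon> where "\<epsilon> u = 2 * D * (exp (\<beta> * t) - exp (\<beta> * u)) / \<beta>" for u
  have ca: "continuous_on {s..t} ?a" and cb: "continuous_on {s..t} ?b"
    using s t a.om_cont_sub b.om_cont_sub by auto
  note cont = ca cb surv_continuous[OF ca] surv_continuous[OF cb]
  have cE: "continuous_on {s..t} \<epsilon>" unfolding \<epsilon>_def by (intro continuous_intros) (use \<beta> in auto)
  have i1: "set_integrable lborel {s..t} (\<lambda>u. ?a u * ?A u * f u)"
    and i2: "set_integrable lborel {s..t} (\<lambda>u. ?a u * ?A u * f' u)"
    and i3: "set_integrable lborel {s..t} (\<lambda>u. ?b u * ?B u * f' u)"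
    using f01 by (auto intro!: a.density_integrable[where C=1] b.density_integrable[where C=1])
  \<comment> \<open>The difference is split through \<open>?a u * ?A u * f' u\<close>: first
    \<open>f\<close> and \<open>f'\<close> are compared under one density, then (\<open>e2\<close>)
    the two densities are compared against \<open>f'\<close>, which has values in [0,1].\<close>
  have e1: "\<bar>LBINT u:{s..t}. ?a u * ?A u * f u - ?a u * ?A u * f' u\<bar> \<le> (LBINT u:{s..t}. ?a u * ?A u * \<epsilon> u)"
  proof -
    have "norm (LBINT u:{s..t}. ?a u * ?A u * f u - ?a u * ?A u * f' u)
        \<le> (LBINT u:{s..t}. norm (?a u * ?A u * f u - ?a u * ?A u * f' u))"
      by (intro set_integral_norm_bound set_integral_diff i1 i2)
    also have "\<dots> \<le> (LBINT u:{s..t}. ?a u * ?A u * \<epsilon> u)"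
    proof (intro set_integral_mono set_integrable_norm set_integral_diff i1 i2
        set_integrable_continuous continuous_on_mult cont cE)
      fix u assume u: "u \<in> {s..t}"
      have "norm (?a u * ?A u * f u - ?a u * ?A u * f' u) = ?a u * ?A u * \<bar>f u - f' u\<bar>"
        using a.om_nonneg by (simp add: right_diff_distrib[symmetric] abs_mult)
      also have "\<dots> \<le> ?a u * ?A u * \<epsilon> u"
        unfolding \<epsilon>_def using u s a.om_nonneg by (intro mult_left_mono ff') auto
      finally show "norm (?a u * ?A u * f u - ?a u * ?A u * f' u) \<le> ?a u * ?A u * \<epsilon> u" .
    qed
    finally show ?thesis by simp
  qed
  have e2: "\<bar>LBINT u:{s..t}. ?a u * ?A u * f' u - ?b u * ?B u * f' u\<bar> \<le> (LBINT u:{s..t}. \<bar>?a u * ?A u - ?b u * ?B u\<bar>)"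
  proof -
    have "norm (LBINT u:{s..t}. ?a u * ?A u * f' u - ?b u * ?B u * f' u)
        \<le> (LBINT u:{s..t}. norm (?a u * ?A u * f' u - ?b u * ?B u * f' u))"
      by (intro set_integral_norm_bound set_integral_diff i3 i2)
    also have "\<dots> \<le> (LBINT u:{s..t}. \<bar>?a u * ?A u - ?b u * ?B u\<bar>)"
    proof (intro set_integral_mono set_integrable_norm set_integral_diff i3 i2
        set_integrable_continuous continuous_intros cont)
      fix u assume u: "u \<in> {s..t}"
      have "norm (?a u * ?A u * f' u - ?b u * ?B u * f' u) = \<bar>?a u * ?A u - ?b u * ?B u\<bar> * f' u"
        using f01(2)[of u] by (simp add: left_diff_distrib[symmetric] abs_mult)
      also have "\<dots> \<le> \<bar>?a u * ?A u - ?b u * ?B u\<bar>"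
        using f01(2)[of u] by (intro mult_left_le) auto
      finally show "norm (?a u * ?A u * f' u - ?b u * ?B u * f' u) \<le> \<bar>?a u * ?A u - ?b u * ?B u\<bar>" .
    qed
    finally show ?thesis by simp
  qed
  have e3: "(LBINT u:{s..t}. \<bar>?a u - ?b u\<bar> * ?A u) \<le> (LBINT u:{s..t}. D * exp (\<beta> * u) * ?A u)"
    using om s by (intro set_integral_mono set_integrable_continuous continuous_intros cont mult_right_mono) auto
  have e4: "(LBINT u:{s..t}. ?a u * ?A u * \<epsilon> u + 2 * (D * exp (\<beta> * u) * ?A u)) = \<epsilon> s"
  proof -
    have d\<epsilon>: "(\<epsilon> has_real_derivative - (2 * D * exp (\<beta> * u))) (at u within {s..t})" for u
      unfolding \<epsilon>_def using \<beta> by (auto intro!: derivative_eq_intros)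
    have "(LBINT u:{s..t}. ?a u * ?A u * \<epsilon> u + 2 * (D * exp (\<beta> * u) * ?A u))
        = - (?A t * \<epsilon> t) - - (?A s * \<epsilon> s)"
    proof (rule set_integral_FTC)
      show "continuous_on {s..t} (\<lambda>u. ?a u * ?A u * \<epsilon> u + 2 * (D * exp (\<beta> * u) * ?A u))"
        by (intro continuous_intros cont cE)
      fix u assume u: "u \<in> {s..t}"
      show "((\<lambda>u. - (?A u * \<epsilon> u)) has_real_derivative ?a u * ?A u * \<epsilon> u + 2 * (D * exp (\<beta> * u) * ?A u)) (at u within {s..t})"
        by (rule DERIV_cong[OF DERIV_minus[OF DERIV_mult[OF surv_deriv[OF ca u] d\<epsilon>]]]) (simp add: algebra_simps)
    qed (use s in auto)
    then show ?thesis by (simp add: \<epsilon>_def)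
  qed
  have i4: "set_integrable lborel {s..t} (\<lambda>u. ?a u * ?A u * \<epsilon> u)"
    and i5: "set_integrable lborel {s..t} (\<lambda>u. 2 * (D * exp (\<beta> * u) * ?A u))"
    by (intro set_integrable_continuous continuous_intros cont cE)+
  have e5: "(LBINT u:{s..t}. \<bar>?a u * ?A u - ?b u * ?B u\<bar>) + \<bar>?A t - ?B t\<bar> \<le> 2 * (LBINT u:{s..t}. \<bar>?a u - ?b u\<bar> * ?A u)"
    using s b.om_nonneg by (intro surv_density_diff ca cb) auto
  have e6: "\<bar>indicator {..t0} s * ?A t - indicator {..t0} s * ?B t\<bar> \<le> \<bar>?A t - ?B t\<bar>"
    by (auto simp: indicator_def)
  show ?thesis
    using e1 e2 e3 e4 e5 e6 set_integral_diff(2)[OF i1 i2] set_integral_diff(2)[OF i2 i3] set_integral_add(2)[OF i4 i5] s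
    unfolding \<epsilon>_def[symmetric] jump_op_def set_integral_mult_right by (simp add: abs_le_iff)
qed

text \<open>\<open>jump_op_diff\<close> returns the bound it was given, so the estimate is the same
  for every \<open>n\<close> and survives the passage to the limit.\<close>

lemma jump_op_iterate_diff:
  assumes "intensity T B om" "intensity T B' om'"
    and "0 < \<beta>" and t: "t \<le> T"
    and "\<And>s u. 0 \<le> s \<Longrightarrow> s \<le> u \<Longrightarrow> u \<le> t \<Longrightarrow> \<bar>om s u - om' s u\<bar> \<le> D * exp (\<beta> * u)"
    and D: "0 \<le> D" and "s \<in> {0..t}"
  shows "\<bar>(jump_op om t0 t ^^ n) (\<lambda>_. 0) s - (jump_op om' t0 t ^^ n) (\<lambda>_. 0) s\<bar>
     \<le> 2 * D * (exp (\<beta> * t) - exp (\<beta> * s)) / \<beta>"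
  using assms(7)
proof (induction n arbitrary: s)
  case 0
  then show ?case using assms by simp
next
  case (Suc n)
  show ?case
    using jump_op_diff[OF assms(1-5) intensity.jump_op_iterate(1)[OF assms(1) t] intensity.jump_op_iterate(1)[OF assms(2) t]
      intensity.jump_op_iterate(2)[OF assms(1) t] intensity.jump_op_iterate(2)[OF assms(2) t] Suc]
    by simp
qed

section \<open>Point processes with an intensity\<close>

text \<open>Two intensities occur: \<open>om0\<close> is the one in the hypothesis on the process,
  \<open>om\<close> a globally measurable and bounded version that agrees with it on the triangle. A
  jump time up to \<open>t\<close> sees only values on the triangle, so \<open>om\<close> can
  replace \<open>om0\<close> in every formula.\<close>

locale counting_process = intensity T B om for T B om +
  fixes M :: "'a measure" and N :: "'a \<Rightarrow> real \<Rightarrow> nat" and om0 :: "real \<Rightarrow> real \<Rightarrow> real"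
  assumes T_pos: "0 < T"
    and pp: "point_process T M N om0"
    and om_eq: "\<And>s u. 0 \<le> s \<Longrightarrow> s \<le> u \<Longrightarrow> u \<le> T \<Longrightarrow> om s u = om0 s u"
begin

sublocale prob_space M
  using pp by (simp add: point_process_def)

lemma N_measurable [measurable (raw)]: "t \<in> {0..T} \<Longrightarrow> (\<lambda>x. N x t) \<in> measurable M (count_space UNIV)"
  using pp by (simp add: point_process_def)

lemma N_mono: "x \<in> space M \<Longrightarrow> 0 \<le> s \<Longrightarrow> s \<le> t \<Longrightarrow> t \<le> T \<Longrightarrow> N x s \<le> N x t"
  and N_right_cont: "x \<in> space M \<Longrightarrow> t \<in> {0..T} \<Longrightarrow> continuous (at t within {t..T}) (\<lambda>s. real (N x s))"
  using pp by (auto simp: point_process_def mono_on_def)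

lemma jump_time_bounds:
  assumes "s \<in> {0..T}" "k \<le> N x s"
  shows "jump_time T N k x = ereal (Inf {t\<in>{0..T}. k \<le> N x t})"
    "0 \<le> Inf {t\<in>{0..T}. k \<le> N x t}" "Inf {t\<in>{0..T}. k \<le> N x t} \<le> s"
  using assms by (auto simp: jump_time_def intro!: cInf_greatest cInf_lower bdd_belowI[where m=0])

text \<open>The infimum is attained: if \<open>N x\<close> were still below \<open>k\<close> at the
  infimum \<open>i\<close>, right-continuity would keep it below \<open>k\<close> just after
  \<open>i\<close>, and no point of the set would lie near \<open>i\<close>.\<close>

lemma jump_time_le_iff:
  assumes s: "s \<in> {0..T}" and x: "x \<in> space M"
  shows "jump_time T N k x \<le> ereal s \<longleftrightarrow> k \<le> N x s"
proof
  assume "k \<le> N x s"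
  then show "jump_time T N k x \<le> ereal s" using jump_time_bounds[OF s] by simp
next
  let ?S = "{t\<in>{0..T}. k \<le> N x t}"
  assume le: "jump_time T N k x \<le> ereal s"
  then have ex: "\<exists>t\<in>{0..T}. k \<le> N x t" by (auto simp: jump_time_def split: if_splits)
  then obtain t where t: "t \<in> {0..T}" "k \<le> N x t" by blast
  define i where "i = Inf ?S"
  have i: "0 \<le> i" "i \<le> t" "i \<le> s" using jump_time_bounds[OF t] le by (simp_all add: i_def)
  then have iT: "i \<in> {0..T}" using t by auto
  have "k \<le> N x i"
  proof (rule ccontr)
    assume less: "\<not> k \<le> N x i"
    have "((\<lambda>s. real (N x s)) \<longlongrightarrow> real (N x i)) (at i within {i..T})"
      using N_right_cont[OF x iT] by (simp add: continuous_within)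
    then have "eventually (\<lambda>s. real (N x s) < real k) (at i within {i..T})"
      by (rule order_tendstoD) (use less in simp)
    then obtain d where d: "0 < d" "\<And>s. s \<in> {i..T} \<Longrightarrow> s \<noteq> i \<Longrightarrow> dist s i < d \<Longrightarrow> real (N x s) < real k"
      unfolding eventually_at by blast
    have "Inf ?S < i + d" using d by (simp add: i_def)
    then obtain y where y: "y \<in> ?S" "y < i + d" using cInf_lessD[of ?S "i + d"] t by blast
    have "i \<le> y" unfolding i_def using y by (intro cInf_lower) (auto intro!: bdd_belowI[where m=0])
    with d(2)[of y] y less show False by (auto simp: dist_real_def)
  qed
  also have "N x i \<le> N x s" using N_mono[OF x] i s by auto
  finally show "k \<le> N x s" .
qed

text \<open>The jump times as real random variables: \<open>T + 1\<close> stands for no \<open>k\<close>-th jump up to time \<open>T\<close>.\<close>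
definition X :: "nat \<Rightarrow> 'a \<Rightarrow> real" where
  "X k x = (if k \<le> N x T then real_of_ereal (jump_time T N k x) else T + 1)"

lemma X_le_iff: "x \<in> space M \<Longrightarrow> a \<in> {0..T} \<Longrightarrow> X k x \<le> a \<longleftrightarrow> k \<le> N x a"
proof -
  assume x: "x \<in> space M" and a: "a \<in> {0..T}"
  have "N x a \<le> N x T" using N_mono[OF x] a by auto
  then show ?thesis
    using jump_time_le_iff[OF a x, of k] jump_time_bounds[of T k x] T_pos a by (auto simp: X_def)
qed

lemma X_nonneg: "0 \<le> X k x"
  using jump_time_bounds[of T k x] T_pos by (auto simp: X_def)

lemma X_zero: "x \<in> space M \<Longrightarrow> X 0 x = 0"
  using X_le_iff[of x 0 0] X_nonneg[of 0 x] T_pos by auto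

lemma X_measurable [measurable]: "X k \<in> borel_measurable M"
proof (subst borel_measurable_iff_le, rule allI)
  fix a
  have le: "X k x \<le> T + 1" if "x \<in> space M" for x
    using X_le_iff[OF that, of T k] T_pos by (auto simp: X_def split: if_splits)
  have gt: "X k x \<le> a \<longleftrightarrow> k \<le> N x T" if "x \<in> space M" "T \<le> a" "a < T + 1" for x
    using X_le_iff[OF that(1), of T k] T_pos that by (auto simp: X_def split: if_splits)
  \<comment> \<open>The values of \<open>X k\<close> lie in \<open>{0..T}\<close> or equal
    \<open>T + 1\<close>, so strictly between \<open>T\<close> and \<open>T + 1\<close> the event no
    longer depends on \<open>a\<close>.\<close>
  consider "a < 0" | "a \<in> {0..T}" | "T < a" "a < T + 1" | "T + 1 \<le> a" by fastforce
  then show "{x \<in> space M. X k x \<le> a} \<in> sets M"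
  proof cases
    case 1
    then have empty: "{x \<in> space M. X k x \<le> a} = {}" by (auto dest: order_trans[OF X_nonneg])
    show ?thesis unfolding empty by simp
  next
    case 2
    then have "{x \<in> space M. X k x \<le> a} = {x \<in> space M. k \<le> N x a}" using X_le_iff by auto
    then show ?thesis using 2 by simp
  next
    case 3
    then have "{x \<in> space M. X k x \<le> a} = {x \<in> space M. k \<le> N x T}" using gt by auto
    then show ?thesis using T_pos by simp
  next
    case 4
    then have "{x \<in> space M. X k x \<le> a} = space M" using le by force
    then show ?thesis by simp
  qed
qed

text \<open>The event is that the \<open>k\<close>-th jump has happened by time \<open>a\<close>,
  which is known at the \<open>k\<close>-th jump time. These are the test events to which the
  conditional survival formula is applied.\<close>

lemma event_in_stopped_sigma:
  assumes a: "a \<in> {0..T}"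
  shows "{x \<in> space M. k \<le> N x a} \<in> stopped_sigma T M N (jump_time T N k)"
proof -
  have nf: "{x \<in> space M. k \<le> N x s} \<in> nat_filtration M N t" if "s \<in> {0..T}" "s \<le> t" for s t
  proof -
    have "{x \<in> space M. k \<le> N x s} = (\<lambda>x. N x s) -` {k..} \<inter> space M" by auto
    then show ?thesis unfolding nat_filtration_def using that by (intro sigma_sets.Basic) auto
  qed
  have "{x \<in> space M. k \<le> N x a} \<inter> {x \<in> space M. jump_time T N k x \<le> ereal t} = {x \<in> space M. k \<le> N x (min a t)}"
    if "t \<in> {0..T}" for t
    using jump_time_le_iff[OF that, of _ k] N_mono[of _ a t] N_mono[of _ t a] a that
    by (auto simp: min_def) (use le_trans in blast)+
  then show ?thesis using nf a by (auto simp: stopped_sigma_def)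
qed

text \<open>Having \<open>k\<close> jumps at both times means that jump \<open>k\<close> comes no
  later than \<open>a\<close> and jump \<open>k + 1\<close> after \<open>b\<close>. The conditional
  survival formula at the \<open>k\<close>-th jump time, integrated over the first event, gives the
  right-hand side.\<close>

lemma no_jump_prob:
  assumes "0 \<le> a" "a \<le> b" "b \<le> T"
  shows "measure M {x \<in> space M. N x a = k \<and> N x b = k}
    = (\<integral>x. indicator {..a} (X k x) * surv (om (X k x)) (X k x) b \<partial>M)"
proof -
  have a: "a \<in> {0..T}" and b: "b \<in> {0..T}" using assms by auto
  let ?A = "{x \<in> space M. k \<le> N x a}"
  have "measure M {x \<in> ?A. jump_time T N k x \<le> ereal b \<and> ereal b < jump_time T N (Suc k) x} =
        (\<integral>x. indicator {x \<in> ?A. jump_time T N k x \<le> ereal b} x *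
              exp (- (LBINT u:{real_of_ereal (jump_time T N k x)..b}.
                        om0 (real_of_ereal (jump_time T N k x)) u)) \<partial>M)"
  proof -
    have "\<forall>k\<ge>1. \<forall>t\<in>{0..T}. \<forall>A\<in>stopped_sigma T M N (jump_time T N (k - 1)).
        measure M {x \<in> A. jump_time T N (k - 1) x \<le> ereal t \<and> ereal t < jump_time T N k x} =
        (\<integral>x. indicator {x \<in> A. jump_time T N (k - 1) x \<le> ereal t} x *
              exp (- (LBINT u:{real_of_ereal (jump_time T N (k - 1) x)..t}.
                        om0 (real_of_ereal (jump_time T N (k - 1) x)) u)) \<partial>M)"
      using pp unfolding point_process_def by blast
    from this[rule_format, of "Suc k" b ?A] show ?thesis
      using event_in_stopped_sigma[OF a, of k] b by simp
  qed
  also have "{x \<in> ?A. jump_time T N k x \<le> ereal b \<and> ereal b < jump_time T N (Suc k) x} = {x \<in> space M. N x a = k \<and> N x b = k}"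
    using jump_time_le_iff[OF b] assms N_mono[of _ a b] by (fastforce simp: not_le[symmetric])
  also have "(\<integral>x. indicator {x \<in> ?A. jump_time T N k x \<le> ereal b} x *
              exp (- (LBINT u:{real_of_ereal (jump_time T N k x)..b}.
                        om0 (real_of_ereal (jump_time T N k x)) u)) \<partial>M)
     = (\<integral>x. indicator {..a} (X k x) * surv (om (X k x)) (X k x) b \<partial>M)"
  proof (rule Bochner_Integration.integral_cong[OF refl])
    fix x assume x: "x \<in> space M"
    show "indicator {x \<in> ?A. jump_time T N k x \<le> ereal b} x *
              exp (- (LBINT u:{real_of_ereal (jump_time T N k x)..b}.
                        om0 (real_of_ereal (jump_time T N k x)) u)) =
      indicator {..a} (X k x) * surv (om (X k x)) (X k x) b"
    proof (cases "k \<le> N x a")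
      case True
      have le: "N x a \<le> N x b" "N x b \<le> N x T" using N_mono[OF x] assms by auto
      then have "real_of_ereal (jump_time T N k x) = X k x" using True by (simp add: X_def)
      moreover have "(LBINT u:{X k x..b}. om0 (X k x) u) = (LBINT u:{X k x..b}. om (X k x) u)"
        using assms by (intro set_lebesgue_integral_cong) (auto simp: om_eq X_nonneg)
      ultimately show ?thesis
        using True x le jump_time_le_iff[OF b x] X_le_iff[OF x a] by (simp add: surv_def)
    next
      case False
      then show ?thesis using X_le_iff[OF x a] by simp
    qed
  qed
  finally show ?thesis .
qed

section \<open>Laws of the successive jump times\<close>

definition \<nu> :: "nat \<Rightarrow> real measure" where
  "\<nu> k = distr M borel (X k)"

lemma sets_\<nu> [measurable_cong, simp]: "sets (\<nu> k) = sets borel"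
  by (simp add: \<nu>_def)

lemma space_\<nu> [simp]: "space (\<nu> k) = UNIV"
  by (simp add: \<nu>_def)

lemma prob_space_\<nu>: "prob_space (\<nu> k)"
  unfolding \<nu>_def by (rule prob_space_distr) simp

lemma no_jump_prob_\<nu>:
  assumes "0 \<le> a" "a \<le> b" "b \<le> T"
  shows "measure M {x \<in> space M. N x a = k \<and> N x b = k}
    = (\<integral>s. indicator {..a} s * surv (om s) s b \<partial>\<nu> k)"
  unfolding no_jump_prob[OF assms] \<nu>_def by (subst integral_distr) auto

lemma \<nu>_atMost: "a \<in> {0..T} \<Longrightarrow> measure (\<nu> k) {..a} = measure M {x \<in> space M. k \<le> N x a}"
  unfolding \<nu>_def by (subst measure_distr) (auto intro!: arg_cong[where f="measure M"] simp: X_le_iff)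

lemma \<nu>_neg: "x < 0 \<Longrightarrow> measure (\<nu> k) {..x} = 0"
proof -
  assume "x < 0"
  then have "X k -` {..x} \<inter> space M = {}" by (auto dest: order_trans[OF X_nonneg])
  then show ?thesis unfolding \<nu>_def by (subst measure_distr) auto
qed

lemma AE_\<nu>: "AE s in \<nu> k. 0 \<le> s"
  unfolding \<nu>_def by (subst AE_distr_iff) (auto simp: X_nonneg)

text \<open>At least \<open>k\<close> jumps by time \<open>a\<close> means either exactly
  \<open>k\<close> or at least \<open>k + 1\<close>; the probability of the first case is
  \<open>no_jump_prob_\<nu>\<close> with both times equal to \<open>a\<close>.\<close>

lemma \<nu>_Suc_atMost:
  assumes a: "a \<in> {0..T}"
  shows "measure (\<nu> (Suc k)) {..a} = (\<integral>s. indicator {0..a} s * (1 - surv (om s) s a) \<partial>\<nu> k)"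
proof -
  interpret n: prob_space "\<nu> k" by (rule prob_space_\<nu>)
  have "measure M {x \<in> space M. k \<le> N x a} = measure M {x \<in> space M. N x a = k} + measure M {x \<in> space M. Suc k \<le> N x a}"
    using a by (subst finite_measure_Union[symmetric]) (auto intro!: arg_cong[where f="measure M"])
  then have "measure (\<nu> (Suc k)) {..a} = measure (\<nu> k) {..a} - (\<integral>s. indicator {..a} s * surv (om s) s a \<partial>\<nu> k)"
    using no_jump_prob_\<nu>[of a a k] a by (simp add: \<nu>_atMost)
  also have "measure (\<nu> k) {..a} = (\<integral>s. indicator {..a} s \<partial>\<nu> k)" by simp
  also have "(\<integral>s. indicator {..a} s \<partial>\<nu> k) - (\<integral>s. indicator {..a} s * surv (om s) s a \<partial>\<nu> k)
     = (\<integral>s. indicator {..a} s - indicator {..a} s * surv (om s) s a \<partial>\<nu> k)"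
    by (subst Bochner_Integration.integral_diff)
      (auto intro!: n.integrable_const_bound[where B=1] simp: surv_om_le_1 indicator_def)
  also have "\<dots> = (\<integral>s. indicator {0..a} s * (1 - surv (om s) s a) \<partial>\<nu> k)"
    by (rule integral_cong_AE) (use AE_\<nu>[of k] in \<open>auto simp: indicator_def\<close>)
  finally show ?thesis .
qed

text \<open>The law of the \<open>(k+1)\<close>-st jump time on \<open>[0, t]\<close>, built from that of the \<open>k\<close>-th.\<close>
definition next_jump :: "nat \<Rightarrow> real \<Rightarrow> real measure" where
  "next_jump k t = distr (density (\<nu> k \<Otimes>\<^sub>M lborel)
     (\<lambda>(s, u). if 0 \<le> s \<and> s \<le> u \<and> u \<le> t then ennreal (om s u * surv (om s) s u) else 0)) borel snd"

text \<open>Tonelli, with the next jump time integrated out first. Nonnegative integrals are used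
  because finiteness of \<open>next_jump k t\<close> is itself derived from this formula.\<close>

lemma nn_integral_next_jump:
  assumes [measurable]: "f \<in> borel_measurable borel" and f: "\<And>u. f u \<in> {0..1}"
  shows "(\<integral>\<^sup>+u. ennreal (f u) \<partial>next_jump k t)
    = (\<integral>\<^sup>+s. ennreal (indicator {0..t} s * (LBINT u:{s..t}. om s u * surv (om s) s u * f u)) \<partial>\<nu> k)"
proof -
  interpret n: prob_space "\<nu> k" by (rule prob_space_\<nu>)
  interpret p: pair_sigma_finite "\<nu> k" lborel ..
  let ?d = "\<lambda>s u. if 0 \<le> s \<and> s \<le> u \<and> u \<le> t then ennreal (om s u * surv (om s) s u) else 0"
  have d: "case_prod ?d \<in> borel_measurable (\<nu> k \<Otimes>\<^sub>M lborel)" by measurable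
  have "(\<integral>\<^sup>+u. ennreal (f u) \<partial>next_jump k t) = (\<integral>\<^sup>+p. case_prod ?d p * ennreal (f (snd p)) \<partial>(\<nu> k \<Otimes>\<^sub>M lborel))"
    unfolding next_jump_def using d
    by (subst nn_integral_distr) (auto simp: nn_integral_density)
  also have "\<dots> = (\<integral>\<^sup>+s. \<integral>\<^sup>+u. ?d s u * ennreal (f u) \<partial>lborel \<partial>\<nu> k)"
    using d by (subst lborel.nn_integral_fst[symmetric]) auto
  also have "\<dots> = (\<integral>\<^sup>+s. ennreal (indicator {0..t} s * (LBINT u:{s..t}. om s u * surv (om s) s u * f u)) \<partial>\<nu> k)"
  proof (rule nn_integral_cong)
    fix s
    have i: "set_integrable lborel {s..t} (\<lambda>u. om s u * surv (om s) s u * f u)"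
      using f by (intro density_integrable[where C=1]) auto
    have "(\<integral>\<^sup>+u. ?d s u * ennreal (f u) \<partial>lborel) =
       (\<integral>\<^sup>+u. indicator {0..t} s * ennreal (indicator {s..t} u *\<^sub>R (om s u * surv (om s) s u * f u)) \<partial>lborel)"
      using f om_nonneg by (intro nn_integral_cong) (auto simp: indicator_def ennreal_mult[symmetric])
    also have "\<dots> = indicator {0..t} s * (\<integral>\<^sup>+u. ennreal (indicator {s..t} u *\<^sub>R (om s u * surv (om s) s u * f u)) \<partial>lborel)"
      by (intro nn_integral_cmult) measurable
    also have "(\<integral>\<^sup>+u. ennreal (indicator {s..t} u *\<^sub>R (om s u * surv (om s) s u * f u)) \<partial>lborel)
        = ennreal (LBINT u:{s..t}. om s u * surv (om s) s u * f u)"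
      unfolding set_lebesgue_integral_def using i f om_nonneg
      by (intro nn_integral_eq_integral) (auto simp: set_integrable_def)
    finally show "(\<integral>\<^sup>+u. ?d s u * ennreal (f u) \<partial>lborel)
        = ennreal (indicator {0..t} s * (LBINT u:{s..t}. om s u * surv (om s) s u * f u))"
      by (auto simp: indicator_def)
  qed
  finally show ?thesis .
qed

text \<open>The hypothesis on \<open>x\<close> says that \<open>a\<close> is the minimum of
  \<open>x\<close> and \<open>t\<close>, so thresholds beyond \<open>t\<close> are covered as well.
  The inner integral is then \<open>1 - surv (om s) s a\<close>, matching
  \<open>\<nu>_Suc_atMost\<close>.\<close>

lemma next_jump_atMost:
  assumes a: "0 \<le> a" "a \<le> t" "t \<le> T" and x: "{..x} \<inter> {..t} = {..a}"
  shows "emeasure (next_jump k t) {..x} = ennreal (measure (\<nu> (Suc k)) {..a})"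
proof -
  interpret n: prob_space "\<nu> k" by (rule prob_space_\<nu>)
  have "emeasure (next_jump k t) {..x} = (\<integral>\<^sup>+u. ennreal (indicator {..x} u) \<partial>next_jump k t)"
    by (simp add: ennreal_indicator next_jump_def)
  also have "\<dots> = (\<integral>\<^sup>+s. ennreal (indicator {0..t} s * (LBINT u:{s..t}. om s u * surv (om s) s u * indicator {..x} u)) \<partial>\<nu> k)"
    by (rule nn_integral_next_jump) auto
  also have "\<dots> = (\<integral>\<^sup>+s. ennreal (indicator {0..a} s * (1 - surv (om s) s a)) \<partial>\<nu> k)"
  proof (rule nn_integral_cong)
    fix s
    have ind: "u \<le> t \<Longrightarrow> u \<le> x \<longleftrightarrow> u \<le> a" for u using x by auto
    have "(LBINT u:{s..t}. om s u * surv (om s) s u * indicator {..x} u) = (LBINT u:{s..a}. om s u * surv (om s) s u)"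
      unfolding set_lebesgue_integral_def
      by (rule Bochner_Integration.integral_cong) (use ind a in \<open>auto simp: indicator_def\<close>)
    moreover have "(LBINT u:{s..a}. om s u * surv (om s) s u) = 1 - surv (om s) s a" if "0 \<le> s" "s \<le> a"
      using that a by (intro surv_density_integral om_cont_sub) auto
    moreover have "(LBINT u:{s..a}. om s u * surv (om s) s u) = 0" if "a < s"
      using that by (simp add: set_lebesgue_integral_def)
    ultimately show "ennreal (indicator {0..t} s * (LBINT u:{s..t}. om s u * surv (om s) s u * indicator {..x} u))
      = ennreal (indicator {0..a} s * (1 - surv (om s) s a))"
      using a by (auto simp: indicator_def not_le)
  qed
  also have "\<dots> = ennreal (\<integral>s. indicator {0..a} s * (1 - surv (om s) s a) \<partial>\<nu> k)"
    by (intro nn_integral_eq_integral n.integrable_const_bound[where B=1])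
      (auto simp: surv_om_le_1 indicator_def)
  finally show ?thesis using a by (simp add: \<nu>_Suc_atMost)
qed

text \<open>Finite Borel measures on the line with the same distribution function coincide. This
  turns the survival formula, which speaks of half-lines only, into an identity of measures that can
  be integrated against any test function.\<close>

lemma next_jump_eq:
  assumes t: "0 \<le> t" "t \<le> T"
  shows "density (\<nu> (Suc k)) (indicator {..t}) = next_jump k t"
proof -
  interpret n: prob_space "\<nu> (Suc k)" by (rule prob_space_\<nu>)
  let ?M1 = "density (\<nu> (Suc k)) (indicator {..t})" and ?M2 = "next_jump k t"
  have e1: "emeasure ?M1 A = emeasure (\<nu> (Suc k)) (A \<inter> {..t})" if "A \<in> sets borel" for A
    using that by (subst emeasure_density) (auto simp: indicator_inter_arith[symmetric] Int_commute)
  have neg: "emeasure ?M2 {..x} = 0" if "x < 0" for x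
  proof -
    have "emeasure ?M2 {..x} = (\<integral>\<^sup>+u. ennreal (indicator {..x} u) \<partial>next_jump k t)"
      by (simp add: ennreal_indicator next_jump_def)
    also have "\<dots> = (\<integral>\<^sup>+s. ennreal (indicator {0..t} s * (LBINT u:{s..t}. om s u * surv (om s) s u * indicator {..x} u)) \<partial>\<nu> k)"
      by (rule nn_integral_next_jump) auto
    also have "\<dots> = (\<integral>\<^sup>+s. 0 \<partial>\<nu> k)"
    proof (rule nn_integral_cong)
      fix s
      have "(LBINT u:{s..t}. om s u * surv (om s) s u * indicator {..x} u) = (LBINT u:{s..t}. 0)" if "0 \<le> s"
        using that \<open>x < 0\<close> by (intro set_lebesgue_integral_cong) auto
      then show "ennreal (indicator {0..t} s * (LBINT u:{s..t}. om s u * surv (om s) s u * indicator {..x} u)) = 0"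
        by (auto simp: indicator_def)
    qed
    finally show ?thesis by simp
  qed
  \<comment> \<open>No mass lies beyond \<open>t\<close>, so the total mass is the value of the
    distribution function at \<open>t\<close>; finiteness is required before distribution functions
    can identify the measure.\<close>
  have "emeasure ?M2 UNIV = (\<integral>\<^sup>+u. ennreal 1 \<partial>next_jump k t)"
    by (simp add: next_jump_def)
  also have "\<dots> = (\<integral>\<^sup>+s. ennreal (indicator {0..t} s * (LBINT u:{s..t}. om s u * surv (om s) s u * 1)) \<partial>\<nu> k)"
    by (rule nn_integral_next_jump) auto
  also have "\<dots> = (\<integral>\<^sup>+s. ennreal (indicator {0..t} s * (LBINT u:{s..t}. om s u * surv (om s) s u * indicator {..t} u)) \<partial>\<nu> k)"
    by (intro nn_integral_cong arg_cong[where f=ennreal] arg_cong2[where f="(*)"] set_lebesgue_integral_cong) auto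
  also have "\<dots> = (\<integral>\<^sup>+u. ennreal (indicator {..t} u) \<partial>next_jump k t)"
    by (rule nn_integral_next_jump[symmetric]) auto
  also have "\<dots> = emeasure ?M2 {..t}"
    by (simp add: ennreal_indicator next_jump_def)
  also have "\<dots> < \<infinity>" using t by (subst next_jump_atMost[where a=t]) auto
  finally have fin: "emeasure ?M2 (space ?M2) < \<infinity>" by (simp add: next_jump_def)
  show ?thesis
  proof (rule cdf_unique')
    show "finite_borel_measure ?M1"
    proof (intro finite_borel_measure.intro finite_measureI finite_borel_measure_axioms.intro)
      show "emeasure ?M1 (space ?M1) \<noteq> \<infinity>" using e1[of UNIV] by simp
    qed simp
    show "finite_borel_measure ?M2"
    proof (intro finite_borel_measure.intro finite_measureI finite_borel_measure_axioms.intro)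
      show "emeasure ?M2 (space ?M2) \<noteq> \<infinity>" using fin by simp
    qed (simp add: next_jump_def)
    show "cdf ?M1 = cdf ?M2"
    proof
      fix x
      have "emeasure ?M1 {..x} = emeasure ?M2 {..x}"
      proof (cases "x < 0")
        case True
        have "{..x} \<inter> {..t} = {..x}" using True t by auto
        then show ?thesis using True \<nu>_neg[OF True, of "Suc k"] by (simp add: neg e1 n.emeasure_eq_measure)
      next
        case False
        have "{..x} \<inter> {..t} = {..min x t}" by auto
        then show ?thesis using False t
          by (subst next_jump_atMost[where a="min x t"]) (auto simp: e1 n.emeasure_eq_measure)
      qed
      then show "cdf ?M1 x = cdf ?M2 x" by (simp add: cdf_def measure_def)
    qed
  qed
qed

lemma integral_\<nu>_Suc:
  assumes t: "0 \<le> t" "t \<le> T" and [measurable]: "f \<in> borel_measurable borel" and f: "\<And>u. f u \<in> {0..1}"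
  shows "(\<integral>s. indicator {0..t} s * f s \<partial>\<nu> (Suc k))
    = (\<integral>s. indicator {0..t} s * (LBINT u:{s..t}. om s u * surv (om s) s u * f u) \<partial>\<nu> k)"
proof -
  have "(\<integral>\<^sup>+s. ennreal (indicator {0..t} s * f s) \<partial>\<nu> (Suc k)) = (\<integral>\<^sup>+s. indicator {..t} s * ennreal (f s) \<partial>\<nu> (Suc k))"
    by (rule nn_integral_cong_AE) (use AE_\<nu>[of "Suc k"] in \<open>auto simp: indicator_def\<close>)
  also have "\<dots> = (\<integral>\<^sup>+s. ennreal (f s) \<partial>next_jump k t)"
    unfolding next_jump_eq[OF t, symmetric] by (subst nn_integral_density) auto
  also have "\<dots> = (\<integral>\<^sup>+s. ennreal (indicator {0..t} s * (LBINT u:{s..t}. om s u * surv (om s) s u * f u)) \<partial>\<nu> k)"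
    by (rule nn_integral_next_jump) (use f in auto)
  finally have eq: "(\<integral>\<^sup>+s. ennreal (indicator {0..t} s * f s) \<partial>\<nu> (Suc k)) = \<dots>" .
  have K: "(\<lambda>s. indicator {0..t} s * (LBINT u:{s..t}. om s u * surv (om s) s u * f u)) \<in> borel_measurable borel"
  proof -
    \<comment> \<open>The value \<open>-1\<close> for \<open>t0\<close> switches the survival term
      off on \<open>{0..t}\<close> and leaves the integral part of the operator alone.\<close>
    have "(\<lambda>s. indicator {0..t} s * (LBINT u:{s..t}. om s u * surv (om s) s u * f u)) = jump_op om (-1) t f"
      by (auto simp: fun_eq_iff jump_op_def)
    then show ?thesis using jump_op_measurable by simp
  qed
  have K0: "0 \<le> (LBINT u:{s..t}. om s u * surv (om s) s u * f u)" for s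
    unfolding set_lebesgue_integral_def using f om_nonneg
    by (intro Bochner_Integration.integral_nonneg) auto
  show ?thesis
    using eq f K K0 by (subst (1 2) integral_eq_nn_integral) (auto intro!: AE_I2)
qed

text \<open>Each application of the operator unrolls one jump: its survival term produces the event
  of \<open>n\<close> jumps at both times, its integral term passes \<open>f\<close> on to the law
  of the next jump. The law \<open>\<nu> 0\<close> is the point mass at 0, hence the evaluation at
  0. The induction varies \<open>f\<close> because its hypothesis is used at
  \<open>jump_op om t0 t f\<close>.\<close>

lemma jump_op_telescope:
  assumes t: "0 \<le> t0" "t0 \<le> t" "t \<le> T" and "f \<in> borel_measurable borel" and "\<And>u. f u \<in> {0..1}"
  shows "(\<Sum>k<n. measure M {x \<in> space M. N x t0 = k \<and> N x t = k}) + (\<integral>s. indicator {0..t} s * f s \<partial>\<nu> n)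
    = (jump_op om t0 t ^^ n) f 0"
  using assms(4,5)
proof (induction n arbitrary: f)
  case (0 f)
  have "(\<integral>s. indicator {0..t} s * f s \<partial>\<nu> 0) = (\<integral>x. indicator {0..t} (X 0 x) * f (X 0 x) \<partial>M)"
    unfolding \<nu>_def using 0 by (subst integral_distr) auto
  also have "\<dots> = (\<integral>x. f 0 \<partial>M)"
    using t by (intro Bochner_Integration.integral_cong) (auto simp: X_zero)
  finally have "(\<integral>s. indicator {0..t} s * f s \<partial>\<nu> 0) = (\<integral>x. f 0 \<partial>M)" .
  then show ?case by (simp add: prob_space)
next
  case (Suc n f)
  note [measurable] = Suc(2)
  interpret n: prob_space "\<nu> n" by (rule prob_space_\<nu>)
  let ?K = "\<lambda>s. LBINT u:{s..t}. om s u * surv (om s) s u * f u"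
  have "integrable (\<nu> n) (jump_op om (-1) t f)" "integrable (\<nu> n) (\<lambda>s. indicator {..t0} s * surv (om s) s t)"
    using jump_op_measurable[OF Suc(2)] jump_op_range[OF Suc(2,3) t(3), of "-1"]
    by (auto intro!: n.integrable_const_bound[where B=1] simp: indicator_def surv_om_le_1)
  moreover have "jump_op om (-1) t f = (\<lambda>s. indicator {0..t} s * ?K s)"
    by (auto simp: fun_eq_iff jump_op_def)
  ultimately have i: "integrable (\<nu> n) (\<lambda>s. indicator {0..t} s * ?K s)" "integrable (\<nu> n) (\<lambda>s. indicator {..t0} s * surv (om s) s t)"
    by simp_all
  have \<nu>_Suc: "(\<integral>s. indicator {0..t} s * f s \<partial>\<nu> (Suc n)) = (\<integral>s. indicator {0..t} s * ?K s \<partial>\<nu> n)"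
    by (rule integral_\<nu>_Suc[OF _ t(3) Suc(2,3)]) (use t in simp)
  have "measure M {x \<in> space M. N x t0 = n \<and> N x t = n} + (\<integral>s. indicator {0..t} s * f s \<partial>\<nu> (Suc n))
      = (\<integral>s. indicator {..t0} s * surv (om s) s t + indicator {0..t} s * ?K s \<partial>\<nu> n)"
    using no_jump_prob_\<nu>[OF t, of n] i by (simp add: \<nu>_Suc)
  also have "\<dots> = (\<integral>s. indicator {0..t} s * jump_op om t0 t f s \<partial>\<nu> n)"
  proof (rule integral_cong_AE)
    show "AE s in \<nu> n. indicator {..t0} s * surv (om s) s t + indicator {0..t} s * ?K s = indicator {0..t} s * jump_op om t0 t f s"
      using AE_\<nu>[of n] by eventually_elim (use t in \<open>auto simp: jump_op_def indicator_def\<close>)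
    show "(\<lambda>s. indicator {0..t} s * jump_op om t0 t f s) \<in> borel_measurable (\<nu> n)"
      using jump_op_measurable[OF Suc(2)] by simp
  qed (use i in auto)
  finally show ?case
    using Suc.IH[of "jump_op om t0 t f"] jump_op_measurable[OF Suc(2)] jump_op_range[OF Suc(2,3) t(3)]
    by (simp add: funpow_swap1)
qed

lemma same_count_sums:
  assumes t: "0 \<le> t0" "t0 \<le> t" "t \<le> T"
  shows "(\<lambda>k. measure M {x \<in> space M. N x t0 = k \<and> N x t = k}) sums measure M {x \<in> space M. N x t = N x t0}"
proof -
  let ?A = "\<lambda>k. {x \<in> space M. N x t0 = k \<and> N x t = k}"
  have "(\<lambda>k. measure M (?A k)) sums measure M (\<Union>k. ?A k)"
    using t by (intro finite_measure_UNION) (auto simp: disjoint_family_on_def)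
  also have "(\<Union>k. ?A k) = {x \<in> space M. N x t = N x t0}" by auto
  finally show ?thesis .
qed

text \<open>For \<open>f = 0\<close> the remainder integral in the telescoping identity vanishes, so
  the iterates are the partial sums over the number of jumps.\<close>

lemma jump_op_iterate_tendsto:
  assumes t: "0 \<le> t0" "t0 \<le> t" "t \<le> T"
  shows "(\<lambda>n. (jump_op om t0 t ^^ n) (\<lambda>_. 0) 0) \<longlonglongrightarrow> measure M {x \<in> space M. N x t = N x t0}"
  using same_count_sums[OF t] jump_op_telescope[OF t, of "\<lambda>_. 0"] by (simp add: sums_def)

section \<open>Dependence of the no-jump probability on its two times\<close>

lemma same_count_prob_ge:
  assumes t: "0 \<le> s" "s \<le> t" "t \<le> T"
  shows "1 - B * (t - s) \<le> measure M {x \<in> space M. N x t = N x s}"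
proof -
  let ?p = "\<lambda>a b k. measure M {x \<in> space M. N x a = k \<and> N x b = k}"
  \<comment> \<open>Both probabilities integrate a survival factor against the same law of the
    \<open>k\<close>-th jump, so the pointwise bound \<open>surv_extend_ge\<close> carries over.
    Summed over \<open>k\<close>, the left-hand probabilities have total mass 1.\<close>
  have le: "?p s s k * (1 - B * (t - s)) \<le> ?p s t k" for k
  proof -
    interpret n: prob_space "\<nu> k" by (rule prob_space_\<nu>)
    have i: "integrable (\<nu> k) (\<lambda>r. indicator {..s} r * surv (om r) r b)" for b
      by (auto intro!: n.integrable_const_bound[where B=1] simp: indicator_def surv_om_le_1)
    have "?p s s k * (1 - B * (t - s)) = (\<integral>r. indicator {..s} r * surv (om r) r s * (1 - B * (t - s)) \<partial>\<nu> k)"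
      using no_jump_prob_\<nu>[of s s k] t by simp
    also have "\<dots> \<le> (\<integral>r. indicator {..s} r * surv (om r) r t \<partial>\<nu> k)"
    proof (rule integral_mono_AE)
      show "AE r in \<nu> k. indicator {..s} r * surv (om r) r s * (1 - B * (t - s)) \<le> indicator {..s} r * surv (om r) r t"
        using AE_\<nu>[of k]
      proof eventually_elim
        case (elim r)
        then show ?case
          using surv_extend_ge[OF om_cont_sub, of r t s B] t om_nonneg om_le
          by (auto simp: indicator_def)
      qed
    qed (use i in auto)
    finally show ?thesis using t by (simp add: no_jump_prob_\<nu>)
  qed
  have "?p s s sums 1" using same_count_sums[of s s] t by (simp add: prob_space)
  then have "(\<lambda>k. ?p s s k * (1 - B * (t - s))) sums (1 * (1 - B * (t - s)))"
    by (rule sums_mult2)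
  from sums_le[OF _ this same_count_sums[OF t]] le show ?thesis by simp
qed

lemma same_count_event:
  assumes "s \<in> {0..T}" "t \<in> {0..T}"
  shows "{x \<in> space M. N x t = N x s} \<in> events" "{x \<in> space M. N x t \<noteq> N x s} \<in> events"
proof -
  have "{x \<in> space M. N x t = N x s} = (\<Union>k. ((\<lambda>x. N x s) -` {k} \<inter> space M) \<inter> ((\<lambda>x. N x t) -` {k} \<inter> space M))"
    by auto
  also have "\<dots> \<in> events"
  proof (rule sets.countable_UN, safe)
    fix k
    show "((\<lambda>x. N x s) -` {k} \<inter> space M) \<inter> ((\<lambda>x. N x t) -` {k} \<inter> space M) \<in> events"
      by (rule sets.Int[OF measurable_sets[OF N_measurable[OF assms(1)]] measurable_sets[OF N_measurable[OF assms(2)]]]) auto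
  qed
  finally show 1: "{x \<in> space M. N x t = N x s} \<in> events" .
  have "{x \<in> space M. N x t \<noteq> N x s} = space M - {x \<in> space M. N x t = N x s}" by auto
  then show "{x \<in> space M. N x t \<noteq> N x s} \<in> events" using 1 by simp
qed

lemma count_change_prob_le:
  assumes "s \<in> {0..T}" "t \<in> {0..T}"
  shows "prob {x \<in> space M. N x t \<noteq> N x s} \<le> B * \<bar>t - s\<bar>"
proof -
  have le: "prob {x \<in> space M. N x t \<noteq> N x s} \<le> B * (t - s)"
    if "0 \<le> s" "s \<le> t" "t \<le> T" for s t
  proof -
    have "{x \<in> space M. N x t \<noteq> N x s} = space M - {x \<in> space M. N x t = N x s}" by auto
    moreover have "{x \<in> space M. N x t = N x s} \<in> events" using that by (intro same_count_event) auto
    ultimately have "prob {x \<in> space M. N x t \<noteq> N x s} = 1 - prob {x \<in> space M. N x t = N x s}"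
      using prob_compl by simp
    then show ?thesis using same_count_prob_ge[OF that] by simp
  qed
  show ?thesis
  proof (cases "s \<le> t")
    case True
    then show ?thesis using le[of s t] assms by simp
  next
    case False
    have "{x \<in> space M. N x t \<noteq> N x s} = {x \<in> space M. N x s \<noteq> N x t}" by auto
    then show ?thesis using le[of t s] assms False by simp
  qed
qed

text \<open>If one event occurs and the other does not, the count has changed between
  \<open>b\<close> and \<open>b'\<close> or between \<open>a\<close> and \<open>a'\<close>. No order
  among the four times is involved.\<close>

lemma same_count_prob_diff:
  assumes "a \<in> {0..T}" "b \<in> {0..T}" "a' \<in> {0..T}" "b' \<in> {0..T}"
  shows "\<bar>prob {x \<in> space M. N x b = N x a} - prob {x \<in> space M. N x b' = N x a'}\<bar> \<le> B * (\<bar>b - b'\<bar> + \<bar>a - a'\<bar>)"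
proof -
  have le: "prob {x \<in> space M. N x b = N x a} \<le> prob {x \<in> space M. N x b' = N x a'} + B * (\<bar>b - b'\<bar> + \<bar>a - a'\<bar>)"
    if ab: "a \<in> {0..T}" "b \<in> {0..T}" "a' \<in> {0..T}" "b' \<in> {0..T}" for a b a' b'
  proof -
    let ?S = "\<lambda>a b. {x \<in> space M. N x b = N x a}" and ?D = "\<lambda>a b. {x \<in> space M. N x b \<noteq> N x a}"
    have [measurable]: "?S a b \<in> events" "?S a' b' \<in> events" "?D b' b \<in> events" "?D a' a \<in> events"
      using ab by (simp_all add: same_count_event)
    have "prob (?S a b) \<le> prob (?S a' b' \<union> (?D b' b \<union> ?D a' a))"
      by (rule finite_measure_mono) auto
    also have "\<dots> \<le> prob (?S a' b') + prob (?D b' b \<union> ?D a' a)"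
      by (rule measure_Un_le) auto
    also have "prob (?D b' b \<union> ?D a' a) \<le> prob (?D b' b) + prob (?D a' a)"
      by (rule measure_Un_le) auto
    also have "\<dots> \<le> B * \<bar>b - b'\<bar> + B * \<bar>a - a'\<bar>"
      using ab by (intro add_mono count_change_prob_le)
    finally show ?thesis by (simp add: distrib_left)
  qed
  show ?thesis
    using le[OF assms] le[OF assms(3,4,1,2)] by (simp add: abs_le_iff abs_minus_commute)
qed

lemma same_count_prob_mono:
  assumes "0 \<le> a" "a \<le> a'" "a' \<le> b'" "b' \<le> b" "b \<le> T"
  shows "prob {x \<in> space M. N x b = N x a} \<le> prob {x \<in> space M. N x b' = N x a'}"
proof (rule finite_measure_mono)
  show "{x \<in> space M. N x b' = N x a'} \<in> events" using assms by (intro same_count_event) auto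
  show "{x \<in> space M. N x b = N x a} \<subseteq> {x \<in> space M. N x b' = N x a'}"
  proof safe
    fix x assume x: "x \<in> space M" and eq: "N x b = N x a"
    have "N x a \<le> N x a'" "N x a' \<le> N x b'" "N x b' \<le> N x b"
      using N_mono[OF x] assms by auto
    with eq show "N x b' = N x a'" by simp
  qed
qed

end

section \<open>Flows\<close>

lemma compact_rect: "compact (rect T)"
  by (simp add: rect_def compact_Times)

lemma C1_rect_continuous: "C1_rect T w \<Longrightarrow> continuous_on (rect T) w"
  unfolding C1_rect_def continuous_on_eq_continuous_within by (blast intro: has_derivative_continuous)

lemma abs_le_supnorm:
  assumes "continuous_on (rect T) w" "p \<in> rect T"
  shows "\<bar>w p\<bar> \<le> supnorm T w"
proof -
  have "compact ((\<lambda>p. \<bar>w p\<bar>) ` rect T)"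
    by (intro compact_continuous_image continuous_intros assms compact_rect)
  then show ?thesis
    unfolding supnorm_def using assms(2)
    by (intro cSUP_upper bounded_imp_bdd_above compact_imp_bounded)
qed

lemma supnorm_le:
  assumes "0 \<le> T" "\<And>p. p \<in> rect T \<Longrightarrow> \<bar>w p\<bar> \<le> B"
  shows "supnorm T w \<le> B"
  unfolding supnorm_def by (rule cSUP_least) (use assms in \<open>auto simp: rect_def\<close>)

text \<open>Uniqueness of derivatives on a closed interval identifies the witness \<open>D1\<close>
  with \<open>partial_y w\<close>, endpoints included; the mean value inequality does the
  rest.\<close>

lemma C1_rect_Lipschitz:
  assumes w: "C1_rect T w" and C: "\<And>p. p \<in> rect T \<Longrightarrow> \<bar>partial_y w p\<bar> \<le> C"
    and y: "y \<in> {0..1}" "y' \<in> {0..1}" and t: "t \<in> {0..T}"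
  shows "\<bar>w (y, t) - w (y', t)\<bar> \<le> C * \<bar>y - y'\<bar>"
proof -
  obtain D1 D2 where D: "\<And>p. p \<in> rect T \<Longrightarrow> (w has_derivative (\<lambda>(h,k). D1 p * h + D2 p * k)) (at p within rect T)"
    using w unfolding C1_rect_def by blast
  have d: "((\<lambda>y. w (y, t)) has_real_derivative D1 (y, t)) (at y within {0..1})" if "y \<in> {0..1}" for y
  proof -
    have "((\<lambda>y. (y, t)) has_derivative (\<lambda>h. (h, 0))) (at y within {0..1})"
      by (auto intro!: derivative_eq_intros)
    from has_derivative_in_compose2[of "rect T" w, OF D _ that this]
    have "((\<lambda>y. w (y, t)) has_derivative (\<lambda>h. D1 (y, t) * h)) (at y within {0..1})"
      using t by (simp add: rect_def image_subset_iff)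
    then show ?thesis by (simp add: has_field_derivative_def)
  qed
  have "\<bar>D1 (y, t)\<bar> \<le> C" if "y \<in> {0..1}" for y
  proof -
    have "partial_y w (y, t) = D1 (y, t)"
      unfolding partial_y_def using d[OF that] that
      by (auto intro!: vector_derivative_within_closed_interval simp: has_real_derivative_iff_has_vector_derivative)
    then show ?thesis using C[of "(y, t)"] that t by (auto simp: rect_def)
  qed
  then show ?thesis
    using field_differentiable_bound[of "{0..1}" "\<lambda>y. w (y, t)" "\<lambda>y. D1 (y, t)" C y y'] d y by auto
qed

section \<open>Flows and their closure under uniform limits\<close>

lemma Delta_iff:
  "((y0, t0), t) \<in> Delta T \<longleftrightarrow> t \<in> {0..T} \<and> t0 \<in> {0..t} \<and> y0 \<in> {0..1} \<and> (y0 = 0 \<or> t0 = 0)"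
  by (auto simp: Delta_def Gamma_def Gamma_t_def Gamma_b_def Gamma_i_def)

lemma Gamma_t_iff: "t \<in> {0..T} \<Longrightarrow> \<gamma> \<in> Gamma_t t \<longleftrightarrow> (\<gamma>, t) \<in> Delta T"
  by (auto simp: Delta_def Gamma_def Gamma_t_def Gamma_b_def Gamma_i_def)

lemma Gamma_iff: "(y0, t0) \<in> Gamma T \<longleftrightarrow> ((y0, t0), t0) \<in> Delta T" if "0 \<le> T"
  using that by (auto simp: Delta_def Gamma_def Gamma_t_def Gamma_b_def Gamma_i_def)

lemma Theta_continuous:
  assumes "\<theta> \<in> Theta T" "continuous_on S g" "continuous_on S h" "\<And>x. x \<in> S \<Longrightarrow> (g x, h x) \<in> Delta T"
  shows "continuous_on S (\<lambda>x. \<theta> (g x) (h x))"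
proof -
  have "continuous_on (Delta T) (\<lambda>(\<gamma>, t). \<theta> \<gamma> t)" using assms(1) by (simp add: Theta_def)
  from continuous_on_compose2[OF this continuous_on_Pair[OF assms(2,3)]] assms(4) show ?thesis by auto
qed

lemma Theta_range: "\<theta> \<in> Theta T \<Longrightarrow> (\<gamma>, t) \<in> Delta T \<Longrightarrow> 0 \<le> \<theta> \<gamma> t \<and> \<theta> \<gamma> t \<le> 1"
  unfolding Theta_def mem_Collect_eq atLeastAtMost_iff by blast

lemma Theta_start: "\<theta> \<in> Theta T \<Longrightarrow> (y0, t0) \<in> Gamma T \<Longrightarrow> \<theta> (y0, t0) t0 = y0"
  unfolding Theta_def mem_Collect_eq by blast

lemma Theta_outside: "\<theta> \<in> Theta T \<Longrightarrow> (\<gamma>, t) \<notin> Delta T \<Longrightarrow> \<theta> \<gamma> t = 0"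
  unfolding Theta_def mem_Collect_eq by blast

text \<open>Surjectivity of \<open>\<theta>(\<cdot>, t)\<close> is automatic: \<open>\<Gamma>\<^sub>t\<close> is an arc on whose ends
  \<open>(0, t)\<close> and \<open>(1, 0)\<close> the remaining conditions force the values \<open>0\<close> and \<open>1\<close>.\<close>
lemma ThetaI:
  assumes T: "0 \<le> T"
    and cont: "continuous_on (Delta T) (\<lambda>(\<gamma>, t). \<theta> \<gamma> t)"
    and range: "\<And>\<gamma> t. (\<gamma>, t) \<in> Delta T \<Longrightarrow> 0 \<le> \<theta> \<gamma> t \<and> \<theta> \<gamma> t \<le> 1"
    and start: "\<And>y0 t0. ((y0, t0), t0) \<in> Delta T \<Longrightarrow> \<theta> (y0, t0) t0 = y0"
    and mono_i: "\<And>z y t. 0 \<le> z \<Longrightarrow> z \<le> y \<Longrightarrow> y \<le> 1 \<Longrightarrow> t \<in> {0..T} \<Longrightarrow> \<theta> (z, 0) t \<le> \<theta> (y, 0) t"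
    and mono_b: "\<And>s r t. 0 \<le> s \<Longrightarrow> s \<le> r \<Longrightarrow> r \<le> t \<Longrightarrow> t \<le> T \<Longrightarrow> \<theta> (0, r) t \<le> \<theta> (0, s) t"
    and mono_t: "\<And>\<gamma> t t'. (\<gamma>, t) \<in> Delta T \<Longrightarrow> (\<gamma>, t') \<in> Delta T \<Longrightarrow> t \<le> t' \<Longrightarrow> \<theta> \<gamma> t \<le> \<theta> \<gamma> t'"
    and outside: "\<And>\<gamma> t. (\<gamma>, t) \<notin> Delta T \<Longrightarrow> \<theta> \<gamma> t = 0"
  shows "\<theta> \<in> Theta T"
proof -
  have surj: "(\<lambda>\<gamma>. \<theta> \<gamma> t) ` Gamma_t t = {0..1}" if t: "t \<in> {0..T}" for t
  proof (intro equalityI subsetI)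
    fix y assume "y \<in> (\<lambda>\<gamma>. \<theta> \<gamma> t) ` Gamma_t t"
    then show "y \<in> {0..1}" using range t by (auto simp: Gamma_t_iff)
  next
    fix y :: real assume y: "y \<in> {0..1}"
    \<comment> \<open>The arc is unrolled onto the interval from \<open>-t\<close> to
      \<open>1\<close>: negative parameters are entrance times on the boundary leg, positive ones
      are initial positions, and 0 is the corner.\<close>
    define p where "p r = (max r 0, max (- r) (0::real))" for r
    have pD: "(p r, t) \<in> Delta T" if "r \<in> {- t..1}" for r
      using that t by (auto simp: p_def Delta_iff max_def)
    have "continuous_on {- t..1} (\<lambda>r. (p r, t))"
      unfolding p_def by (intro continuous_intros)
    from continuous_on_compose2[OF cont this]
    have c: "continuous_on {- t..1} (\<lambda>r. \<theta> (p r) t)" using pD by (simp add: image_subset_iff)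
    have "\<theta> (p (- t)) t = 0"
      using start[of 0 t] t by (auto simp: p_def Delta_iff)
    moreover have "\<theta> (1, 0) 0 \<le> \<theta> (1, 0) t" using t by (intro mono_t) (auto simp: Delta_iff)
    then have "\<theta> (p 1) t \<ge> 1"
      using start[of 1 0] t by (auto simp: p_def Delta_iff)
    ultimately obtain r where "r \<in> {- t..1}" "\<theta> (p r) t = y"
      using IVT'[of "\<lambda>r. \<theta> (p r) t" "- t" y 1] c y t by auto
    then show "y \<in> (\<lambda>\<gamma>. \<theta> \<gamma> t) ` Gamma_t t"
      using pD[of r] t by (force simp: Gamma_t_iff)
  qed
  have mono: "\<theta> \<gamma> t \<le> \<theta> \<gamma>' t"
    if t: "t \<in> {0..T}" and "(\<gamma>, t) \<in> Delta T" "(\<gamma>', t) \<in> Delta T" and g: "gsucceq T \<gamma> \<gamma>'" for t \<gamma> \<gamma>'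
  proof -
    obtain y s y' s' where [simp]: "\<gamma> = (y, s)" "\<gamma>' = (y', s')" by (cases \<gamma>, cases \<gamma>')
    consider "y = 0" "y' = 0" "s' \<le> s" | "y = 0" "s' = 0" | "s = 0" "s' = 0" "y \<le> y'"
      using g by (auto simp: gsucceq_def)
    then show ?thesis
    proof cases
      case 2
      \<comment> \<open>Points on different legs of the arc are compared through the corner
        \<open>(0, 0)\<close>.\<close>
      have "\<theta> (0, s) t \<le> \<theta> (0, 0) t" using that t by (intro mono_b) (auto simp: Delta_iff)
      also have "\<theta> (0, 0) t \<le> \<theta> (y', 0) t" using that t 2 by (intro mono_i) (auto simp: Delta_iff)
      finally show ?thesis using 2 by simp
    qed (use that t mono_i mono_b in \<open>auto simp: Delta_iff\<close>)
  qed
  show ?thesis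
    unfolding Theta_def mem_Collect_eq atLeastAtMost_iff
    using cont range start surj mono mono_t outside T
    by (intro conjI allI ballI impI) (simp_all add: Gamma_iff Gamma_t_iff[of _ T])
qed

lemma Theta_mono:
  assumes "\<theta> \<in> Theta T"
  shows "0 \<le> z \<Longrightarrow> z \<le> y \<Longrightarrow> y \<le> 1 \<Longrightarrow> t \<in> {0..T} \<Longrightarrow> \<theta> (z, 0) t \<le> \<theta> (y, 0) t"
    and "0 \<le> s \<Longrightarrow> s \<le> r \<Longrightarrow> r \<le> t \<Longrightarrow> t \<le> T \<Longrightarrow> \<theta> (0, r) t \<le> \<theta> (0, s) t"
    and "(\<gamma>, t) \<in> Delta T \<Longrightarrow> (\<gamma>, t') \<in> Delta T \<Longrightarrow> t \<le> t' \<Longrightarrow> \<theta> \<gamma> t \<le> \<theta> \<gamma> t'"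
proof -
  have m: "\<theta> \<gamma> t \<le> \<theta> \<gamma>' t" if "t \<in> {0..T}" "\<gamma> \<in> Gamma_t t" "\<gamma>' \<in> Gamma_t t" "gsucceq T \<gamma> \<gamma>'" for \<gamma> \<gamma>' t
    using assms that unfolding Theta_def mem_Collect_eq by blast
  show "0 \<le> z \<Longrightarrow> z \<le> y \<Longrightarrow> y \<le> 1 \<Longrightarrow> t \<in> {0..T} \<Longrightarrow> \<theta> (z, 0) t \<le> \<theta> (y, 0) t"
    by (rule m) (auto simp: Gamma_t_def Gamma_i_def gsucceq_def Gamma_def)
  show "0 \<le> s \<Longrightarrow> s \<le> r \<Longrightarrow> r \<le> t \<Longrightarrow> t \<le> T \<Longrightarrow> \<theta> (0, r) t \<le> \<theta> (0, s) t"
    by (rule m) (auto simp: Gamma_t_def Gamma_b_def gsucceq_def Gamma_def)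
  show "(\<gamma>, t) \<in> Delta T \<Longrightarrow> (\<gamma>, t') \<in> Delta T \<Longrightarrow> t \<le> t' \<Longrightarrow> \<theta> \<gamma> t \<le> \<theta> \<gamma> t'"
    using assms unfolding Theta_def mem_Collect_eq by blast
qed

text \<open>The flow that stands still; it seeds the Picard iteration.\<close>

lemma Theta_nonempty: "0 \<le> T \<Longrightarrow> (\<lambda>\<gamma> t. if (\<gamma>, t) \<in> Delta T then fst \<gamma> else 0) \<in> Theta T"
proof (rule ThetaI)
  have "continuous_on (Delta T) (\<lambda>p. fst (fst p))" by (intro continuous_intros)
  then show "continuous_on (Delta T) (\<lambda>(\<gamma>, t). if (\<gamma>, t) \<in> Delta T then fst \<gamma> else 0)"
    by (rule continuous_on_cong[THEN iffD1, rotated 2]) auto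
qed (auto simp: Delta_iff)

text \<open>Starting values and weak inequalities pass to pointwise limits, and continuity to
  uniform ones. Surjectivity, which is not visibly a closed condition, is supplied by
  \<open>ThetaI\<close>.\<close>

lemma Theta_uniform_limit:
  assumes T: "0 \<le> T" and F: "\<And>n. F n \<in> Theta T"
    and lim: "uniform_limit (Delta T) (\<lambda>n (\<gamma>, t). F n \<gamma> t) (\<lambda>(\<gamma>, t). \<theta> \<gamma> t) sequentially"
    and outside: "\<And>\<gamma> t. (\<gamma>, t) \<notin> Delta T \<Longrightarrow> \<theta> \<gamma> t = 0"
  shows "\<theta> \<in> Theta T"
proof (rule ThetaI[OF T])
  have l: "(\<lambda>n. F n \<gamma> t) \<longlonglongrightarrow> \<theta> \<gamma> t" if "(\<gamma>, t) \<in> Delta T" for \<gamma> t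
    using tendsto_uniform_limitI[OF lim that] by simp
  show "continuous_on (Delta T) (\<lambda>(\<gamma>, t). \<theta> \<gamma> t)"
    by (rule uniform_limit_theorem[OF always_eventually lim]) (use F in \<open>auto simp: Theta_def\<close>)
  show "0 \<le> \<theta> \<gamma> t \<and> \<theta> \<gamma> t \<le> 1" if "(\<gamma>, t) \<in> Delta T" for \<gamma> t
    using Theta_range[OF F that] LIMSEQ_le_const[OF l[OF that]] LIMSEQ_le_const2[OF l[OF that]] by blast
  show "\<theta> (y0, t0) t0 = y0" if "((y0, t0), t0) \<in> Delta T" for y0 t0
  proof -
    have "(y0, t0) \<in> Gamma T" using that T by (simp add: Gamma_iff)
    then have "(\<lambda>n. F n (y0, t0) t0) = (\<lambda>_. y0)" using Theta_start[OF F] by simp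
    then show ?thesis using LIMSEQ_unique[OF l[OF that]] by simp
  qed
  show "\<theta> (z, 0) t \<le> \<theta> (y, 0) t" if "0 \<le> z" "z \<le> y" "y \<le> 1" "t \<in> {0..T}" for z y t
    using Theta_mono(1)[OF F that] that by (intro LIMSEQ_le[OF l l]) (auto simp: Delta_iff)
  show "\<theta> (0, r) t \<le> \<theta> (0, s) t" if "0 \<le> s" "s \<le> r" "r \<le> t" "t \<le> T" for s r t
    using Theta_mono(2)[OF F that] that by (intro LIMSEQ_le[OF l l]) (auto simp: Delta_iff)
  show "\<theta> \<gamma> t \<le> \<theta> \<gamma> t'" if "(\<gamma>, t) \<in> Delta T" "(\<gamma>, t') \<in> Delta T" "t \<le> t'" for \<gamma> t t'
    using Theta_mono(3)[OF F that] that by (intro LIMSEQ_le[OF l l]) auto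
qed (rule outside)

text \<open>Off the triangle \<open>0 \<le> s \<le> u \<le> T\<close> the function \<open>omega \<theta> w z\<close> depends on values of \<open>w\<close> outside
  the rectangle, which are arbitrary.\<close>
definition restrict_triangle :: "real \<Rightarrow> (real \<Rightarrow> real \<Rightarrow> real) \<Rightarrow> real \<Rightarrow> real \<Rightarrow> real" where
  "restrict_triangle T om s u = (if 0 \<le> s \<and> s \<le> u \<and> u \<le> T then om s u else 0)"

text \<open>At \<open>s = 0\<close> the intensity follows the particle started at \<open>z\<close>,
  for \<open>s > 0\<close> the one that enters at time \<open>s\<close>, so joint continuity may
  fail on the line \<open>s = 0\<close>. Joint measurability is obtained by pasting two continuous
  pieces along that line.\<close>

lemma intensity_restrict_triangle_omega:
  assumes T: "0 \<le> T" and \<theta>: "\<theta> \<in> Theta T" and w: "continuous_on (rect T) w" "\<And>p. p \<in> rect T \<Longrightarrow> 0 \<le> w p"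
    and z: "z \<in> {0..1}"
  shows "intensity T (supnorm T w) (restrict_triangle T (omega \<theta> w z))"
proof
  define A where "A = {p::real \<times> real. 0 \<le> fst p \<and> fst p \<le> snd p \<and> snd p \<le> T}"
  have bd: "(\<theta> \<gamma> u, u) \<in> rect T" if "(\<gamma>, u) \<in> Delta T" for \<gamma> u
    using that Theta_range[OF \<theta> that] by (cases \<gamma>) (auto simp: rect_def Delta_iff)
  have c: "continuous_on S (\<lambda>x. w (\<theta> (g x) (h x), h x))"
    if "continuous_on S g" "continuous_on S h" "\<And>x. x \<in> S \<Longrightarrow> (g x, h x) \<in> Delta T"
    for S :: "'x::topological_space set" and g h
    by (rule continuous_on_compose2[OF w(1)], intro continuous_intros Theta_continuous[OF \<theta>])
      (use that bd in blast)+
  have om_pos: "0 \<le> omega \<theta> w z s u \<and> omega \<theta> w z s u \<le> supnorm T w" if "0 \<le> s" "s \<le> u" "u \<le> T" for s u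
  proof -
    have "(\<theta> (if s = 0 then (z, 0) else (0, s)) u, u) \<in> rect T" using that z by (intro bd) (auto simp: Delta_iff)
    from w(2)[OF this] abs_le_supnorm[OF w(1) this] show ?thesis
      by (auto simp: omega_def)
  qed
  have "closed A"
    unfolding A_def by (intro closed_Collect_conj closed_Collect_le continuous_intros)
  then have "(\<lambda>p. indicator A p *\<^sub>R w (\<theta> (0, fst p) (snd p), snd p)) \<in> borel_measurable borel"
    by (intro borel_measurable_continuous_on_indicator c borel_closed continuous_intros) (auto simp: A_def Delta_iff)
  moreover have "(\<lambda>u. indicator {0..T} u *\<^sub>R w (\<theta> (z, 0) u, u)) \<in> borel_measurable borel"
    using z by (intro borel_measurable_continuous_on_indicator c continuous_intros) (auto simp: Delta_iff)
  ultimately have [measurable]: "(\<lambda>p. indicator A p *\<^sub>R w (\<theta> (0, fst p) (snd p), snd p)) \<in> borel_measurable (borel \<Otimes>\<^sub>M borel)"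
    "(\<lambda>u. indicator {0..T} u *\<^sub>R w (\<theta> (z, 0) u, u)) \<in> borel_measurable borel"
    by (simp_all add: borel_prod)
  have "(\<lambda>p. if fst p = 0 then indicator {0..T} (snd p) *\<^sub>R w (\<theta> (z, 0) (snd p), snd p)
      else indicator A p *\<^sub>R w (\<theta> (0, fst p) (snd p), snd p)) \<in> borel_measurable (borel \<Otimes>\<^sub>M borel)"
    by measurable
  also have "(\<lambda>p. if fst p = 0 then indicator {0..T} (snd p) *\<^sub>R w (\<theta> (z, 0) (snd p), snd p)
      else indicator A p *\<^sub>R w (\<theta> (0, fst p) (snd p), snd p)) = case_prod (restrict_triangle T (omega \<theta> w z))"
    by (auto simp: fun_eq_iff restrict_triangle_def omega_def A_def indicator_def)
  finally show "case_prod (restrict_triangle T (omega \<theta> w z)) \<in> borel_measurable (borel \<Otimes>\<^sub>M borel)" .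
  show "0 \<le> restrict_triangle T (omega \<theta> w z) s u" for s u using om_pos by (simp add: restrict_triangle_def)
  have "0 \<le> supnorm T w" using om_pos[of 0 0] T by linarith
  then show "restrict_triangle T (omega \<theta> w z) s u \<le> supnorm T w" for s u using om_pos by (simp add: restrict_triangle_def)
  fix s assume s: "s \<in> {0..T}"
  have "continuous_on {s..T} (\<lambda>u. w (\<theta> (if s = 0 then (z, 0) else (0, s)) u, u))"
    using s z by (intro c continuous_intros) (auto simp: Delta_iff)
  then show "continuous_on {s..T} (restrict_triangle T (omega \<theta> w z) s)"
    by (rule continuous_on_cong[THEN iffD1, rotated 2]) (use s in \<open>auto simp: restrict_triangle_def omega_def\<close>)
qed

section \<open>The map G\<close>

locale flow_model =
  fixes T C :: real and W :: "rfun set" and lam :: "rfun measure"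
    and \<sigma> :: "rfun \<Rightarrow> real \<Rightarrow> real"
    and \<Omega> :: "(real \<times> real \<Rightarrow> real \<Rightarrow> real) \<Rightarrow> rfun \<Rightarrow> real \<Rightarrow> 'a measure"
    and N :: "(real \<times> real \<Rightarrow> real \<Rightarrow> real) \<Rightarrow> rfun \<Rightarrow> real \<Rightarrow> 'a \<Rightarrow> real \<Rightarrow> nat"
  assumes T_pos: "0 < T" and C_nonneg: "0 \<le> C"
    and W_C1: "\<And>w. w \<in> W \<Longrightarrow> C1_rect T w"
    and W_nonneg: "\<And>w p. w \<in> W \<Longrightarrow> p \<in> rect T \<Longrightarrow> 0 \<le> w p"
    and lam_prob: "prob_space lam"
    and lam_space: "space lam = W"
    and lam_sets: "sets lam = borel_supnorm T W"
    and M_W: "(\<integral>\<^sup>+ w. ennreal (supnorm T w) \<partial>lam) < \<infinity>"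
    and C_W: "\<And>w p. w \<in> W \<Longrightarrow> p \<in> rect T \<Longrightarrow> \<bar>partial_y w p\<bar> \<le> C"
    and \<sigma>_meas: "(\<lambda>(w, z). \<sigma> w z) \<in> borel_measurable (lam \<Otimes>\<^sub>M restrict_space lborel {0..1})"
    and \<sigma>_nonneg: "\<And>w z. w \<in> W \<Longrightarrow> z \<in> {0..1} \<Longrightarrow> 0 \<le> \<sigma> w z"
    and mu0_prob: "prob_space (mu0 lam \<sigma>)"
    and \<sigma>_int_w: "\<And>y. y \<in> {0..1} \<Longrightarrow> (\<integral>w. \<sigma> w y \<partial>lam) = 1"
    and \<sigma>_int_z: "\<And>w. w \<in> W \<Longrightarrow> (LBINT z:{0..1}. \<sigma> w z) = 1"
    and N_pp: "\<And>\<theta> w z. \<theta> \<in> Theta T \<Longrightarrow> w \<in> W \<Longrightarrow> z \<in> {0..<1} \<Longrightarrow>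
                 point_process T (\<Omega> \<theta> w z) (N \<theta> w z) (omega \<theta> w z)"
begin

abbreviation R :: "real measure" where "R \<equiv> restrict_space lborel {0..1}"

definition P :: "(real \<times> real \<Rightarrow> real \<Rightarrow> real) \<Rightarrow> real \<Rightarrow> real \<Rightarrow> rfun \<Rightarrow> real \<Rightarrow> real" where
  "P \<theta> t0 t w z = measure (\<Omega> \<theta> w z) {x \<in> space (\<Omega> \<theta> w z). N \<theta> w z x t = N \<theta> w z x t0}"

lemma W_cont: "w \<in> W \<Longrightarrow> continuous_on (rect T) w"
  using W_C1 C1_rect_continuous by blast

lemma counting:
  assumes "\<theta> \<in> Theta T" "w \<in> W" "z \<in> {0..<1}"
  shows "counting_process T (supnorm T w) (restrict_triangle T (omega \<theta> w z)) (\<Omega> \<theta> w z) (N \<theta> w z) (omega \<theta> w z)"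
  unfolding counting_process_def counting_process_axioms_def
  using assms T_pos W_cont W_nonneg N_pp by (auto intro!: intensity_restrict_triangle_omega simp: restrict_triangle_def)

text \<open>The triangle inequality through \<open>w (y', u)\<close> separates the change of
  position, controlled by the Lipschitz constant \<open>C\<close>, from the change of function,
  controlled by the sup norm. One estimate thus serves for varying the flow, \<open>z\<close> and
  \<open>w\<close>.\<close>

lemma omega_diff:
  assumes "\<theta> \<in> Theta T" "\<theta>' \<in> Theta T" "w \<in> W" "w' \<in> W" "z \<in> {0..1}" "z' \<in> {0..1}"
    and su: "0 \<le> s" "s \<le> u" "u \<le> T"
    and le: "\<bar>\<theta> (if s = 0 then (z, 0) else (0, s)) u - \<theta>' (if s = 0 then (z', 0) else (0, s)) u\<bar> \<le> d"
  shows "\<bar>restrict_triangle T (omega \<theta> w z) s u - restrict_triangle T (omega \<theta>' w' z') s u\<bar> \<le> C * d + supnorm T (\<lambda>p. w p - w' p)"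
proof -
  define y where "y = \<theta> (if s = 0 then (z, 0) else (0, s)) u"
  define y' where "y' = \<theta>' (if s = 0 then (z', 0) else (0, s)) u"
  have y: "y \<in> {0..1}" "y' \<in> {0..1}" unfolding y_def y'_def atLeastAtMost_iff
    by (intro Theta_range[OF assms(1)] Theta_range[OF assms(2)], use assms in \<open>simp add: Delta_iff\<close>)+
  have "\<bar>w (y, u) - w (y', u)\<bar> \<le> C * \<bar>y - y'\<bar>"
    using assms y by (intro C1_rect_Lipschitz[OF W_C1 C_W]) auto
  also have "\<dots> \<le> C * d" using le C_nonneg by (intro mult_left_mono) (simp_all add: y_def y'_def)
  finally have "\<bar>w (y, u) - w (y', u)\<bar> \<le> C * d" .
  moreover have "\<bar>w (y', u) - w' (y', u)\<bar> \<le> supnorm T (\<lambda>p. w p - w' p)"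
    using assms y by (intro abs_le_supnorm[where w="\<lambda>p. w p - w' p"] continuous_intros W_cont) (auto simp: rect_def)
  ultimately have "\<bar>w (y, u) - w' (y', u)\<bar> \<le> C * d + supnorm T (\<lambda>p. w p - w' p)" by linarith
  then show ?thesis using su by (auto simp: restrict_triangle_def omega_def y_def y'_def)
qed

text \<open>The bound for the iterates, uniform in \<open>n\<close>, is evaluated at
  \<open>s = 0\<close> and passed to the limit. The two processes may be defined on different
  spaces, and neither sup norm occurs in the bound.\<close>

lemma P_diff:
  assumes "\<theta> \<in> Theta T" "\<theta>' \<in> Theta T" "w \<in> W" "w' \<in> W" "z \<in> {0..<1}" "z' \<in> {0..<1}"
    and t: "0 \<le> t0" "t0 \<le> t" "t \<le> T" and "0 < \<beta>" "0 \<le> D"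
    and D: "\<And>s u. 0 \<le> s \<Longrightarrow> s \<le> u \<Longrightarrow> u \<le> T \<Longrightarrow>
      \<bar>restrict_triangle T (omega \<theta> w z) s u - restrict_triangle T (omega \<theta>' w' z') s u\<bar> \<le> D * exp (\<beta> * u)"
  shows "\<bar>P \<theta> t0 t w z - P \<theta>' t0 t w' z'\<bar> \<le> 2 * D * (exp (\<beta> * t) - 1) / \<beta>"
proof -
  interpret a: counting_process T "supnorm T w" "restrict_triangle T (omega \<theta> w z)" "\<Omega> \<theta> w z" "N \<theta> w z" "omega \<theta> w z"
    using assms by (intro counting)
  interpret b: counting_process T "supnorm T w'" "restrict_triangle T (omega \<theta>' w' z')" "\<Omega> \<theta>' w' z'" "N \<theta>' w' z'" "omega \<theta>' w' z'"
    using assms by (intro counting)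
  have "(\<lambda>n. \<bar>(jump_op (restrict_triangle T (omega \<theta> w z)) t0 t ^^ n) (\<lambda>_. 0) 0 - (jump_op (restrict_triangle T (omega \<theta>' w' z')) t0 t ^^ n) (\<lambda>_. 0) 0\<bar>)
     \<longlonglongrightarrow> \<bar>P \<theta> t0 t w z - P \<theta>' t0 t w' z'\<bar>"
    unfolding P_def by (intro tendsto_intros a.jump_op_iterate_tendsto b.jump_op_iterate_tendsto t)
  moreover have "\<bar>(jump_op (restrict_triangle T (omega \<theta> w z)) t0 t ^^ n) (\<lambda>_. 0) 0 - (jump_op (restrict_triangle T (omega \<theta>' w' z')) t0 t ^^ n) (\<lambda>_. 0) 0\<bar>
     \<le> 2 * D * (exp (\<beta> * t) - exp (\<beta> * 0)) / \<beta>" for n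
    using assms by (intro jump_op_iterate_diff[OF a.intensity_axioms b.intensity_axioms]) auto
  ultimately show ?thesis by (intro LIMSEQ_le_const2) auto
qed

section \<open>Measurability of the no-jump probability in w and z\<close>

lemma supnorm_diff_nonneg: "v \<in> W \<Longrightarrow> w \<in> W \<Longrightarrow> 0 \<le> supnorm T (\<lambda>p. v p - w p)"
proof -
  assume vw: "v \<in> W" "w \<in> W"
  have "(0, 0) \<in> rect T" using T_pos by (auto simp: rect_def)
  from abs_le_supnorm[OF continuous_on_diff[OF W_cont[OF vw(1)] W_cont[OF vw(2)]] this] show ?thesis by linarith
qed

text \<open>The sets open in the sup norm generate the sigma-algebra of \<open>lam\<close>, so a
  Lipschitz function has measurable preimages of open sets.\<close>

lemma supnorm_measurableI:
  assumes "\<And>v w. v \<in> W \<Longrightarrow> w \<in> W \<Longrightarrow> \<bar>f v - f w\<bar> \<le> L * supnorm T (\<lambda>p. w p - v p)"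
  shows "f \<in> borel_measurable lam"
proof (rule borel_measurableI)
  fix S :: "real set" assume S: "open S"
  have "sup_open T W (f -` S \<inter> W)"
    unfolding sup_open_def
  proof (intro conjI ballI)
    fix u assume u: "u \<in> f -` S \<inter> W"
    then obtain e where e: "0 < e" "\<And>y. dist y (f u) < e \<Longrightarrow> y \<in> S" using S unfolding open_dist by auto
    \<comment> \<open>\<open>\<bar>L\<bar> + 1\<close> is a positive Lipschitz constant whatever the
      sign of \<open>L\<close>, so it may be divided by.\<close>
    have "v \<in> f -` S \<inter> W" if "v \<in> W" "supnorm T (\<lambda>p. u p - v p) < e / (\<bar>L\<bar> + 1)" for v
    proof -
      have "\<bar>f v - f u\<bar> \<le> L * supnorm T (\<lambda>p. u p - v p)" using assms that u by simp
      also have "\<dots> \<le> (\<bar>L\<bar> + 1) * supnorm T (\<lambda>p. u p - v p)"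
        using that u by (intro mult_right_mono supnorm_diff_nonneg) auto
      also have "\<dots> < e" using that(2) by (simp add: field_simps)
      finally show ?thesis using e(2)[of "f v"] that by (simp add: dist_real_def)
    qed
    then show "\<exists>e>0. \<forall>v\<in>W. supnorm T (\<lambda>p. u p - v p) < e \<longrightarrow> v \<in> f -` S \<inter> W"
      using e(1) by (intro exI[of _ "e / (\<bar>L\<bar> + 1)"]) auto
  qed auto
  then show "f -` S \<inter> space lam \<in> sets lam"
    unfolding lam_sets lam_space borel_supnorm_def by (intro sigma_sets.Basic) auto
qed

lemma supnorm_measurable [measurable]: "supnorm T \<in> borel_measurable lam"
proof (rule supnorm_measurableI[where L=1])
  have le: "supnorm T v \<le> supnorm T w + supnorm T (\<lambda>p. w p - v p)" if "v \<in> W" "w \<in> W" for v w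
  proof (rule supnorm_le)
    fix p assume p: "p \<in> rect T"
    show "\<bar>v p\<bar> \<le> supnorm T w + supnorm T (\<lambda>p. w p - v p)"
      using abs_le_supnorm[OF W_cont[OF that(2)] p] abs_le_supnorm[OF continuous_on_diff[OF W_cont[OF that(2)] W_cont[OF that(1)]] p]
      by linarith
  qed (use T_pos in simp)
  fix v w assume vw: "v \<in> W" "w \<in> W"
  have "supnorm T (\<lambda>p. v p - w p) = supnorm T (\<lambda>p. w p - v p)"
    by (simp add: supnorm_def abs_minus_commute)
  then show "\<bar>supnorm T v - supnorm T w\<bar> \<le> 1 * supnorm T (\<lambda>p. w p - v p)"
    using le[OF vw] le[OF vw(2,1)] by linarith
qed

lemma supnorm_nonneg: "w \<in> W \<Longrightarrow> 0 \<le> supnorm T w"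
proof -
  assume w: "w \<in> W"
  have "(0, 0) \<in> rect T" using T_pos by (auto simp: rect_def)
  from abs_le_supnorm[OF W_cont[OF w] this] show ?thesis by linarith
qed

lemma P_measurable_w:
  assumes "\<theta> \<in> Theta T" "z \<in> {0..<1}" "0 \<le> t0" "t0 \<le> t" "t \<le> T"
  shows "(\<lambda>w. P \<theta> t0 t w z) \<in> borel_measurable lam"
proof (rule supnorm_measurableI)
  fix v w assume vw: "v \<in> W" "w \<in> W"
  let ?D = "supnorm T (\<lambda>p. w p - v p)"
  \<comment> \<open>Flow and position agree on both sides, so only the sup norm term of
    \<open>omega_diff\<close> remains; the exponent 1 is an arbitrary positive choice.\<close>
  have "\<bar>P \<theta> t0 t w z - P \<theta> t0 t v z\<bar> \<le> 2 * ?D * (exp (1 * t) - 1) / 1"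
  proof (intro P_diff assms vw supnorm_diff_nonneg)
    fix s u :: real assume su: "0 \<le> s" "s \<le> u" "u \<le> T"
    have "\<bar>restrict_triangle T (omega \<theta> w z) s u - restrict_triangle T (omega \<theta> v z) s u\<bar> \<le> C * 0 + ?D"
      using assms vw su by (intro omega_diff) auto
    also have "\<dots> \<le> ?D * exp (1 * u)" using su supnorm_diff_nonneg[OF vw(2,1)] by (simp add: mult_le_cancel_left1)
    finally show "\<bar>restrict_triangle T (omega \<theta> w z) s u - restrict_triangle T (omega \<theta> v z) s u\<bar> \<le> ?D * exp (1 * u)" .
  qed simp
  then show "\<bar>P \<theta> t0 t v z - P \<theta> t0 t w z\<bar> \<le> (2 * (exp t - 1)) * ?D"
    by (simp add: abs_minus_commute algebra_simps)
qed

text \<open>The position \<open>z\<close> enters the intensity only through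
  \<open>\<theta> (z, 0)\<close>, and uniform continuity of the flow on a compact rectangle makes
  that change small at all times simultaneously.\<close>

lemma P_continuous_z:
  assumes \<theta>: "\<theta> \<in> Theta T" and w: "w \<in> W" and t: "0 \<le> t0" "t0 \<le> t" "t \<le> T"
    and z: "z \<in> {0..<1}" "\<And>n. zs n \<in> {0..<1}" "zs \<longlonglongrightarrow> z"
  shows "(\<lambda>n. P \<theta> t0 t w (zs n)) \<longlonglongrightarrow> P \<theta> t0 t w z"
proof (rule LIMSEQ_I)
  fix e :: real assume e: "0 < e"
  \<comment> \<open>The factor that \<open>P_diff\<close> produces, plus one so that it can be
    divided by even when \<open>C = 0\<close>.\<close>
  define K where "K = 2 * C * (exp t - 1) + 1"
  have K: "1 \<le> K" using C_nonneg t by (simp add: K_def)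
  have "continuous_on ({0..1} \<times> {0..T}) (\<lambda>(z, u). \<theta> (z, 0) u)"
    unfolding case_prod_beta' by (intro Theta_continuous[OF \<theta>] continuous_intros) (auto simp: Delta_iff)
  then have "uniformly_continuous_on ({0..1} \<times> {0..T}) (\<lambda>(z, u). \<theta> (z, 0) u)"
    by (intro compact_uniformly_continuous compact_Times) auto
  moreover have "0 < e / (2 * K)" using e K by simp
  ultimately obtain d where d: "0 < d" "\<And>p q. p \<in> {0..1} \<times> {0..T} \<Longrightarrow> q \<in> {0..1} \<times> {0..T} \<Longrightarrow> dist q p < d \<Longrightarrow>
      dist ((\<lambda>(z, u). \<theta> (z, 0) u) q) ((\<lambda>(z, u). \<theta> (z, 0) u) p) < e / (2 * K)"
    unfolding uniformly_continuous_on_def by blast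
  obtain n0 where n0: "\<And>n. n0 \<le> n \<Longrightarrow> \<bar>zs n - z\<bar> < d"
    using LIMSEQ_D[OF z(3) d(1)] by auto
  have "\<bar>P \<theta> t0 t w (zs n) - P \<theta> t0 t w z\<bar> < e" if n: "n0 \<le> n" for n
  proof -
    have "\<bar>P \<theta> t0 t w (zs n) - P \<theta> t0 t w z\<bar> \<le> 2 * (C * (e / (2 * K))) * (exp (1 * t) - 1) / 1"
    proof (intro P_diff \<theta> w z t)
      fix s u :: real assume su: "0 \<le> s" "s \<le> u" "u \<le> T"
      have "\<bar>\<theta> (zs n, 0) u - \<theta> (z, 0) u\<bar> \<le> e / (2 * K)"
        using d(2)[of "(z, u)" "(zs n, u)"] z(1) z(2)[of n] su n0[OF n] by (auto simp: dist_Pair_Pair dist_real_def)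
      then have "\<bar>restrict_triangle T (omega \<theta> w (zs n)) s u - restrict_triangle T (omega \<theta> w z) s u\<bar> \<le> C * (e / (2 * K)) + supnorm T (\<lambda>p. w p - w p)"
        using \<theta> w su z(1) z(2)[of n] e K by (intro omega_diff) auto
      also have "supnorm T (\<lambda>p. w p - w p) \<le> 0" by (rule supnorm_le) (use T_pos in auto)
      also have "C * (e / (2 * K)) + 0 \<le> C * (e / (2 * K)) * exp (1 * u)"
        using mult_left_mono[of 1 "exp (1 * u)" "C * (e / (2 * K))"] su C_nonneg e K by simp
      finally show "\<bar>restrict_triangle T (omega \<theta> w (zs n)) s u - restrict_triangle T (omega \<theta> w z) s u\<bar> \<le> C * (e / (2 * K)) * exp (1 * u)" by simp
    qed (use C_nonneg e K in auto)
    also have "\<dots> = (K - 1) * (e / (2 * K))" by (simp add: K_def)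
    also have "\<dots> \<le> K * (e / (2 * K))" using e K by (intro mult_right_mono) auto
    also have "\<dots> < e" using e K by simp
    finally show ?thesis .
  qed
  then show "\<exists>no. \<forall>n\<ge>no. norm (P \<theta> t0 t w (zs n) - P \<theta> t0 t w z) < e"
    by auto
qed

text \<open>At \<open>z = 1\<close> nothing is assumed about the process, so \<open>P\<close> need not be measurable there.\<close>
definition Q :: "(real \<times> real \<Rightarrow> real \<Rightarrow> real) \<Rightarrow> real \<Rightarrow> real \<Rightarrow> rfun \<times> real \<Rightarrow> real" where
  "Q \<theta> t0 t p = (if snd p < 1 then P \<theta> t0 t (fst p) (snd p) else 0)"

text \<open>A function measurable in \<open>w\<close> and continuous in \<open>z\<close> is jointly
  measurable: it is the limit of its values with \<open>z\<close> rounded down to multiples of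
  \<open>1 / Suc n\<close>. Rounding down keeps the grid points below 1.\<close>

lemma Q_measurable:
  assumes \<theta>: "\<theta> \<in> Theta T" and t: "0 \<le> t0" "t0 \<le> t" "t \<le> T"
  shows "Q \<theta> t0 t \<in> borel_measurable (lam \<Otimes>\<^sub>M R)"
proof (rule borel_measurable_LIMSEQ_real)
  define g where "g n i w = (if 0 \<le> i \<and> i < int (Suc n) then P \<theta> t0 t w (real_of_int i / real (Suc n)) else 0)" for n i w
  have g: "(\<lambda>p. g n i (fst p)) \<in> borel_measurable (lam \<Otimes>\<^sub>M R)" for n i
  proof (cases "0 \<le> i \<and> i < int (Suc n)")
    case True
    then have "real_of_int i / real (Suc n) \<in> {0..<1}" by auto
    from measurable_compose[OF measurable_fst P_measurable_w[OF \<theta> this t]] show ?thesis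
      using True by (simp add: g_def)
  qed (auto simp: g_def)
  have snd: "snd \<in> borel_measurable (lam \<Otimes>\<^sub>M R)"
    by (rule measurable_compose[OF measurable_snd]) (auto intro: measurable_restrict_space1)
  show "(\<lambda>p. g n \<lfloor>real (Suc n) * snd p\<rfloor> (fst p)) \<in> borel_measurable (lam \<Otimes>\<^sub>M R)" for n
    by (rule measurable_compose_countable[OF g]) (use snd in measurable)
  fix p assume "p \<in> space (lam \<Otimes>\<^sub>M R)"
  then have p: "fst p \<in> W" "0 \<le> snd p" "snd p \<le> 1"
    by (auto simp: space_pair_measure lam_space space_restrict_space)
  show "(\<lambda>n. g n \<lfloor>real (Suc n) * snd p\<rfloor> (fst p)) \<longlonglongrightarrow> Q \<theta> t0 t p"
  proof (cases "snd p < 1")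
    case True
    define zs where "zs n = real_of_int \<lfloor>real (Suc n) * snd p\<rfloor> / real (Suc n)" for n
    have fl: "0 \<le> \<lfloor>real (Suc n) * snd p\<rfloor>" "\<lfloor>real (Suc n) * snd p\<rfloor> < int (Suc n)" for n
    proof -
      have "real (Suc n) * snd p < real (Suc n) * 1" using True by (intro mult_strict_left_mono) auto
      then show "0 \<le> \<lfloor>real (Suc n) * snd p\<rfloor>" "\<lfloor>real (Suc n) * snd p\<rfloor> < int (Suc n)"
        using p by (auto simp: floor_less_iff)
    qed
    then have zs01: "zs n \<in> {0..<1}" for n
    proof -
      have "real_of_int \<lfloor>real (Suc n) * snd p\<rfloor> < real_of_int (int (Suc n))"
        using fl(2)[of n] by (simp only: of_int_less_iff)
      then show ?thesis
        using fl(1)[of n] by (simp add: zs_def del: of_nat_Suc)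
    qed
    have "\<bar>zs n - snd p\<bar> \<le> 1 / real (Suc n)" for n
    proof -
      have "\<bar>real_of_int \<lfloor>real (Suc n) * snd p\<rfloor> - real (Suc n) * snd p\<bar> \<le> 1" by linarith
      then have "\<bar>real_of_int \<lfloor>real (Suc n) * snd p\<rfloor> - real (Suc n) * snd p\<bar> / real (Suc n) \<le> 1 / real (Suc n)"
        by (rule divide_right_mono) simp
      also have "\<bar>real_of_int \<lfloor>real (Suc n) * snd p\<rfloor> - real (Suc n) * snd p\<bar> / real (Suc n) = \<bar>zs n - snd p\<bar>"
      proof -
        have "zs n - snd p = (real_of_int \<lfloor>real (Suc n) * snd p\<rfloor> - real (Suc n) * snd p) / real (Suc n)"
          unfolding zs_def diff_divide_distrib by simp
        then show ?thesis by (simp only: abs_divide abs_of_nat)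
      qed
      finally show ?thesis .
    qed
    then have "(\<lambda>n. zs n - snd p) \<longlonglongrightarrow> 0"
      by (intro tendsto_rabs_zero_cancel[OF tendsto_sandwich[OF _ _ tendsto_const LIMSEQ_Suc[OF lim_1_over_n]]])
        (auto intro!: always_eventually simp del: of_nat_Suc)
    then have "zs \<longlonglongrightarrow> snd p" by (simp add: LIM_zero_iff)
    from P_continuous_z[OF \<theta> p(1) t _ zs01 this] True p
    have "(\<lambda>n. P \<theta> t0 t (fst p) (zs n)) \<longlonglongrightarrow> P \<theta> t0 t (fst p) (snd p)" by simp
    then show ?thesis using True fl by (simp add: g_def Q_def zs_def del: of_nat_Suc)
  next
    case False
    then have "snd p = 1" using p by simp
    then show ?thesis by (simp add: g_def Q_def del: of_nat_Suc)
  qed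
qed

section \<open>The measure mu0 and its two marginals\<close>

abbreviation \<mu> :: "(rfun \<times> real) measure" where "\<mu> \<equiv> mu0 lam \<sigma>"

lemma space_\<mu>: "space \<mu> = W \<times> {0..1}"
  by (simp add: mu0_def space_pair_measure lam_space space_restrict_space)

lemma sets_\<mu>: "sets \<mu> = sets (lam \<Otimes>\<^sub>M R)"
  by (simp add: mu0_def)

lemma measurable_\<mu>: "f \<in> borel_measurable (lam \<Otimes>\<^sub>M R) \<Longrightarrow> f \<in> borel_measurable \<mu>"
  by (simp add: measurable_cong_sets[OF sets_\<mu> refl])

lemma sigma_finite_R: "sigma_finite_measure R"
proof -
  have "finite_measure R" by (rule finite_measureI) (simp add: emeasure_restrict_space space_restrict_space)
  then show ?thesis by (rule finite_measure.axioms)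
qed

text \<open>For fixed \<open>w\<close> the density \<sigma> integrates to one in \<open>z\<close>,
  so the first marginal is \<open>lam\<close>; the moment hypothesis on \<open>lam\<close> thereby
  becomes a statement about \<open>\<mu>\<close>.\<close>

lemma nn_integral_\<mu>_fst:
  assumes [measurable]: "f \<in> borel_measurable lam"
  shows "(\<integral>\<^sup>+p. f (fst p) \<partial>\<mu>) = (\<integral>\<^sup>+w. f w \<partial>lam)"
proof -
  interpret R: sigma_finite_measure R by (rule sigma_finite_R)
  note [measurable] = \<sigma>_meas
  have "(\<integral>\<^sup>+p. f (fst p) \<partial>\<mu>) = (\<integral>\<^sup>+p. ennreal (case_prod \<sigma> p) * f (fst p) \<partial>(lam \<Otimes>\<^sub>M R))"
    unfolding mu0_def by (subst nn_integral_density) (auto simp: case_prod_beta')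
  also have "\<dots> = (\<integral>\<^sup>+w. \<integral>\<^sup>+z. ennreal (\<sigma> w z) * f w \<partial>R \<partial>lam)"
    by (subst R.nn_integral_fst[symmetric]) auto
  also have "\<dots> = (\<integral>\<^sup>+w. f w \<partial>lam)"
  proof (rule nn_integral_cong)
    fix w assume "w \<in> space lam"
    then have w: "w \<in> W" by (simp add: lam_space)
    have m: "(\<lambda>z. \<sigma> w z) \<in> borel_measurable R"
      using measurable_compose[OF measurable_Pair1'[OF \<open>w \<in> space lam\<close>] \<sigma>_meas] by simp
    \<comment> \<open>A non-integrable function has integral 0 by convention, so the value 1 forces
      integrability.\<close>
    have i: "integrable lborel (\<lambda>z. indicator {0..1} z *\<^sub>R \<sigma> w z)"
      using \<sigma>_int_z[OF w] not_integrable_integral_eq unfolding set_lebesgue_integral_def by fastforce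
    have "(\<integral>\<^sup>+z. ennreal (\<sigma> w z) \<partial>R) = (\<integral>\<^sup>+z. ennreal (indicator {0..1} z *\<^sub>R \<sigma> w z) \<partial>lborel)"
      by (subst nn_integral_restrict_space) (auto intro!: nn_integral_cong simp: indicator_def)
    also have "\<dots> = ennreal (LBINT z:{0..1}. \<sigma> w z)"
      unfolding set_lebesgue_integral_def using \<sigma>_nonneg[OF w]
      by (intro nn_integral_eq_integral i) (auto simp: indicator_def)
    finally have "(\<integral>\<^sup>+z. ennreal (\<sigma> w z) \<partial>R) = 1" using \<sigma>_int_z[OF w] by simp
    then show "(\<integral>\<^sup>+z. ennreal (\<sigma> w z) * f w \<partial>R) = f w"
      using m by (subst nn_integral_multc) auto
  qed
  finally show ?thesis .
qed

text \<open>For fixed \<open>z\<close> the density \<sigma> integrates to one in \<open>w\<close>,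
  so the second marginal is Lebesgue measure on the unit interval.\<close>

lemma emeasure_\<mu>_strip:
  assumes "0 \<le> a" "a \<le> b" "b \<le> 1"
  shows "emeasure \<mu> {p \<in> space \<mu>. snd p \<in> {a..<b}} = ennreal (b - a)"
proof -
  interpret R: sigma_finite_measure R by (rule sigma_finite_R)
  interpret lam: prob_space lam by (rule lam_prob)
  interpret p: pair_sigma_finite lam R ..
  note [measurable] = \<sigma>_meas
  have snd[measurable]: "snd \<in> borel_measurable (lam \<Otimes>\<^sub>M R)"
    by (rule measurable_compose[OF measurable_snd]) (auto intro: measurable_restrict_space1)
  have A: "{p \<in> space \<mu>. snd p \<in> {a..<b}} = {p \<in> space (lam \<Otimes>\<^sub>M R). snd p \<in> {a..<b}}"
    by (simp add: mu0_def)
  have "emeasure \<mu> {p \<in> space \<mu>. snd p \<in> {a..<b}} =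
      (\<integral>\<^sup>+p. ennreal (case_prod \<sigma> p) * indicator {a..<b} (snd p) \<partial>(lam \<Otimes>\<^sub>M R))"
    unfolding A unfolding mu0_def
    by (subst emeasure_density) (auto intro!: nn_integral_cong simp: indicator_def)
  also have "\<dots> = (\<integral>\<^sup>+z. \<integral>\<^sup>+w. ennreal (\<sigma> w z) * indicator {a..<b} z \<partial>lam \<partial>R)"
    by (subst p.nn_integral_snd[symmetric]) (auto simp: case_prod_beta')
  also have "\<dots> = (\<integral>\<^sup>+z. indicator {a..<b} z \<partial>R)"
  proof (rule nn_integral_cong)
    fix z assume z': "z \<in> space R"
    then have z: "z \<in> {0..1}" by (simp add: space_restrict_space)
    have m: "(\<lambda>w. \<sigma> w z) \<in> borel_measurable lam"
      using measurable_compose[OF measurable_Pair2'[OF z'] \<sigma>_meas] by simp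
    have i: "integrable lam (\<lambda>w. \<sigma> w z)"
      using \<sigma>_int_w[OF z] not_integrable_integral_eq by fastforce
    have "(\<integral>\<^sup>+w. ennreal (\<sigma> w z) \<partial>lam) = ennreal (\<integral>w. \<sigma> w z \<partial>lam)"
      using \<sigma>_nonneg z by (intro nn_integral_eq_integral i) (auto simp: lam_space)
    then show "(\<integral>\<^sup>+w. ennreal (\<sigma> w z) * indicator {a..<b} z \<partial>lam) = indicator {a..<b} z"
      using m \<sigma>_int_w[OF z] by (subst nn_integral_multc) auto
  qed
  also have "\<dots> = (\<integral>\<^sup>+z. indicator {a..<b} z * indicator {0..1} z \<partial>lborel)"
    by (subst nn_integral_restrict_space) auto
  also have "\<dots> = (\<integral>\<^sup>+z. indicator {a..<b} z \<partial>lborel)"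
    using assms by (intro nn_integral_cong) (auto simp: indicator_def)
  also have "\<dots> = ennreal (b - a)" using assms by simp
  finally show ?thesis .
qed

section \<open>Estimates for Q at a fixed pair (w, z)\<close>

lemma Q_range:
  assumes "\<theta> \<in> Theta T" "p \<in> space \<mu>"
  shows "0 \<le> Q \<theta> t0 t p \<and> Q \<theta> t0 t p \<le> 1"
proof (cases "snd p < 1")
  case True
  interpret counting_process T "supnorm T (fst p)" "restrict_triangle T (omega \<theta> (fst p) (snd p))" "\<Omega> \<theta> (fst p) (snd p)"
    "N \<theta> (fst p) (snd p)" "omega \<theta> (fst p) (snd p)"
    using assms True by (intro counting) (auto simp: space_\<mu>)
  show ?thesis using True by (simp add: Q_def P_def)
qed (simp add: Q_def)

text \<open>The Lipschitz constant in time is the sup norm of \<open>w\<close>; it may be unbounded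
  over \<open>W\<close> but has finite mean, so the bound stays useful after integration.\<close>

lemma Q_diff:
  assumes "\<theta> \<in> Theta T" "p \<in> space \<mu>" "a \<in> {0..T}" "b \<in> {0..T}" "a' \<in> {0..T}" "b' \<in> {0..T}"
  shows "\<bar>Q \<theta> a b p - Q \<theta> a' b' p\<bar> \<le> supnorm T (fst p) * (\<bar>b - b'\<bar> + \<bar>a - a'\<bar>)"
proof (cases "snd p < 1")
  case True
  interpret counting_process T "supnorm T (fst p)" "restrict_triangle T (omega \<theta> (fst p) (snd p))" "\<Omega> \<theta> (fst p) (snd p)"
    "N \<theta> (fst p) (snd p)" "omega \<theta> (fst p) (snd p)"
    using assms True by (intro counting) (auto simp: space_\<mu>)
  show ?thesis using same_count_prob_diff[OF assms(3-6)] True by (simp add: Q_def P_def)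
next
  case False
  then show ?thesis using supnorm_nonneg[of "fst p"] assms(2) by (auto simp: Q_def space_\<mu>)
qed

lemma Q_mono:
  assumes "\<theta> \<in> Theta T" "p \<in> space \<mu>" "0 \<le> a" "a \<le> a'" "a' \<le> b'" "b' \<le> b" "b \<le> T"
  shows "Q \<theta> a b p \<le> Q \<theta> a' b' p"
proof (cases "snd p < 1")
  case True
  interpret counting_process T "supnorm T (fst p)" "restrict_triangle T (omega \<theta> (fst p) (snd p))" "\<Omega> \<theta> (fst p) (snd p)"
    "N \<theta> (fst p) (snd p)" "omega \<theta> (fst p) (snd p)"
    using assms True by (intro counting) (auto simp: space_\<mu>)
  show ?thesis using same_count_prob_mono[OF assms(3-7)] True by (simp add: Q_def P_def)
qed (simp add: Q_def)

lemma Q_refl: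
  assumes "\<theta> \<in> Theta T" "p \<in> space \<mu>" "snd p < 1"
  shows "Q \<theta> a a p = 1"
proof -
  interpret counting_process T "supnorm T (fst p)" "restrict_triangle T (omega \<theta> (fst p) (snd p))" "\<Omega> \<theta> (fst p) (snd p)"
    "N \<theta> (fst p) (snd p)" "omega \<theta> (fst p) (snd p)"
    using assms by (intro counting) (auto simp: space_\<mu>)
  show ?thesis using assms by (simp add: Q_def P_def prob_space)
qed

text \<open>With the same \<open>w\<close> and \<open>z\<close> on both sides the sup norm term of
  \<open>omega_diff\<close> disappears and the bound involves only \<open>C\<close>, hence is
  uniform over \<open>W\<close>. The contraction rests on this uniformity.\<close>

lemma Q_diff_flow:
  assumes \<theta>: "\<theta> \<in> Theta T" "\<theta>' \<in> Theta T" and p: "p \<in> space \<mu>" and t: "0 \<le> t0" "t0 \<le> t" "t \<le> T"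
    and \<beta>: "0 < \<beta>" and m: "0 \<le> m"
    and le: "\<And>\<gamma> u. (\<gamma>, u) \<in> Delta T \<Longrightarrow> \<bar>\<theta> \<gamma> u - \<theta>' \<gamma> u\<bar> \<le> m * exp (\<beta> * u)"
  shows "\<bar>Q \<theta> t0 t p - Q \<theta>' t0 t p\<bar> \<le> 2 * (C * m) * (exp (\<beta> * t) - 1) / \<beta>"
proof (cases "snd p < 1")
  case True
  then have w: "fst p \<in> W" "snd p \<in> {0..<1}" using p by (auto simp: space_\<mu>)
  have "\<bar>P \<theta> t0 t (fst p) (snd p) - P \<theta>' t0 t (fst p) (snd p)\<bar> \<le> 2 * (C * m) * (exp (\<beta> * t) - 1) / \<beta>"
  proof (intro P_diff \<theta> w t \<beta>)
    fix s u :: real assume su: "0 \<le> s" "s \<le> u" "u \<le> T"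
    have "\<bar>restrict_triangle T (omega \<theta> (fst p) (snd p)) s u - restrict_triangle T (omega \<theta>' (fst p) (snd p)) s u\<bar>
      \<le> C * (m * exp (\<beta> * u)) + supnorm T (\<lambda>q. fst p q - fst p q)"
      using su w by (intro omega_diff \<theta> le) (auto simp: Delta_iff)
    also have "supnorm T (\<lambda>q. fst p q - fst p q) \<le> 0" by (rule supnorm_le) (use T_pos in auto)
    finally show "\<bar>restrict_triangle T (omega \<theta> (fst p) (snd p)) s u - restrict_triangle T (omega \<theta>' (fst p) (snd p)) s u\<bar> \<le> C * m * exp (\<beta> * u)"
      by (simp add: mult.assoc)
  qed (use C_nonneg m in auto)
  then show ?thesis using True by (simp add: Q_def)
next
  case False
  then show ?thesis using C_nonneg m \<beta> t by (simp add: Q_def)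
qed

sublocale \<mu>: prob_space \<mu>
  by (rule mu0_prob)

section \<open>The integral defining G\<close>

definition H :: "(real \<times> real \<Rightarrow> real \<Rightarrow> real) \<Rightarrow> real \<Rightarrow> real \<Rightarrow> real \<Rightarrow> real" where
  "H \<theta> y0 t0 t = (\<integral>p. indicator {y0..<1} (snd p) * Q \<theta> t0 t p \<partial>\<mu>)"

lemma snd_measurable [measurable]: "snd \<in> borel_measurable \<mu>"
  by (rule measurable_\<mu>, rule measurable_compose[OF measurable_snd]) (auto intro: measurable_restrict_space1)

lemma H_integrable:
  assumes "\<theta> \<in> Theta T" "0 \<le> t0" "t0 \<le> t" "t \<le> T"
  shows "integrable \<mu> (\<lambda>p. indicator {y0..<1} (snd p) * Q \<theta> t0 t p)"
proof (rule \<mu>.integrable_const_bound[where B=1])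
  have [measurable]: "Q \<theta> t0 t \<in> borel_measurable \<mu>" using assms by (intro measurable_\<mu> Q_measurable)
  show "(\<lambda>p. indicator {y0..<1} (snd p) * Q \<theta> t0 t p) \<in> borel_measurable \<mu>" by measurable
qed (use Q_range[OF assms(1)] in \<open>auto simp: indicator_def\<close>)

text \<open>The half-open range of integration excludes \<open>z = 1\<close>, so replacing
  \<open>P\<close> by its measurable modification \<open>Q\<close> does not change the
  integral.\<close>

lemma Gmap_H:
  assumes "((y0, t0), t) \<in> Delta T"
  shows "Gmap T lam \<sigma> \<Omega> N \<theta> (y0, t0) t = 1 - H \<theta> y0 t0 t"
proof -
  have "(\<integral>p. indicator (UNIV \<times> {y0..<1}) p *\<^sub>R (case p of (w, z) \<Rightarrow> P \<theta> t0 t w z) \<partial>\<mu>) = H \<theta> y0 t0 t"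
    unfolding H_def by (rule Bochner_Integration.integral_cong) (auto simp: Q_def indicator_def)
  then show ?thesis using assms by (simp add: Gmap_def set_lebesgue_integral_def P_def)
qed

lemma strip_integral:
  assumes "0 \<le> a" "a \<le> b" "b \<le> 1"
  shows "integrable \<mu> (\<lambda>p. indicator {a..<b} (snd p) :: real)" "(\<integral>p. indicator {a..<b} (snd p) \<partial>\<mu>) = b - a"
proof -
  show "integrable \<mu> (\<lambda>p. indicator {a..<b} (snd p) :: real)"
    by (rule \<mu>.integrable_const_bound[where B=1]) auto
  have "(\<integral>p. indicator {a..<b} (snd p) \<partial>\<mu>) = (\<integral>p. indicator {p \<in> space \<mu>. snd p \<in> {a..<b}} p \<partial>\<mu>)"
    by (rule Bochner_Integration.integral_cong) (auto simp: indicator_def)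
  also have "\<dots> = b - a"
    using emeasure_\<mu>_strip[OF assms] assms by (simp add: measure_def Int_absorb1 subset_eq)
  finally show "(\<integral>p. indicator {a..<b} (snd p) \<partial>\<mu>) = b - a" .
qed

lemma H_refl:
  assumes "\<theta> \<in> Theta T" "0 \<le> y0" "y0 \<le> 1"
  shows "H \<theta> y0 t t = 1 - y0"
proof -
  have "H \<theta> y0 t t = (\<integral>p. indicator {y0..<1} (snd p) \<partial>\<mu>)"
    unfolding H_def by (rule Bochner_Integration.integral_cong) (auto simp: Q_refl[OF assms(1)] indicator_def)
  then show ?thesis using strip_integral(2)[of y0 1] assms by simp
qed

lemma H_range:
  assumes "\<theta> \<in> Theta T" "0 \<le> t0" "t0 \<le> t" "t \<le> T"
  shows "0 \<le> H \<theta> y0 t0 t" "H \<theta> y0 t0 t \<le> 1"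
proof -
  show "0 \<le> H \<theta> y0 t0 t"
    unfolding H_def using Q_range[OF assms(1)] by (intro Bochner_Integration.integral_nonneg) auto
  have "H \<theta> y0 t0 t \<le> (\<integral>p. 1 \<partial>\<mu>)"
    unfolding H_def using Q_range[OF assms(1)]
    by (intro Bochner_Integration.integral_mono H_integrable assms) (auto simp: indicator_def)
  then show "H \<theta> y0 t0 t \<le> 1" by (simp add: \<mu>.prob_space)
qed

lemma H_mono:
  assumes "\<theta> \<in> Theta T" "0 \<le> a" "a \<le> a'" "a' \<le> b'" "b' \<le> b" "b \<le> T" "y' \<le> y"
  shows "H \<theta> y a b \<le> H \<theta> y' a' b'"
  unfolding H_def
proof (intro Bochner_Integration.integral_mono H_integrable)
  fix p assume p: "p \<in> space \<mu>"
  show "indicator {y..<1} (snd p) * Q \<theta> a b p \<le> indicator {y'..<1} (snd p) * Q \<theta> a' b' p"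
    using Q_mono[OF assms(1) p assms(2-6)] Q_range[OF assms(1) p] assms(7) by (auto simp: indicator_def)
qed (use assms in auto)

lemma supnorm_integrable: "integrable \<mu> (\<lambda>p. supnorm T (fst p))"
proof (rule integrableI_bounded)
  have "fst \<in> measurable (lam \<Otimes>\<^sub>M R) lam" by simp
  from measurable_compose[OF this supnorm_measurable]
  show "(\<lambda>p. supnorm T (fst p)) \<in> borel_measurable \<mu>" by (rule measurable_\<mu>)
  have "(\<integral>\<^sup>+p. ennreal (norm (supnorm T (fst p))) \<partial>\<mu>) = (\<integral>\<^sup>+p. ennreal (supnorm T (fst p)) \<partial>\<mu>)"
    using supnorm_nonneg by (intro nn_integral_cong) (auto simp: space_\<mu>)
  also have "\<dots> = (\<integral>\<^sup>+w. ennreal (supnorm T w) \<partial>lam)"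
    by (rule nn_integral_\<mu>_fst) measurable
  finally show "(\<integral>\<^sup>+p. ennreal (norm (supnorm T (fst p))) \<partial>\<mu>) < \<infinity>" using M_W by simp
qed

text \<open>Moving \<open>y\<close> alters the integrand on a strip of measure
  \<open>\<bar>y - y'\<bar>\<close>, where it is at most 1; moving the times costs the sup norm of
  \<open>w\<close> times the displacement, which is integrable.\<close>

lemma H_Lipschitz:
  assumes \<theta>: "\<theta> \<in> Theta T" and D: "((y, a), b) \<in> Delta T" "((y', a'), b') \<in> Delta T"
  shows "\<bar>H \<theta> y a b - H \<theta> y' a' b'\<bar> \<le> \<bar>y - y'\<bar> + (\<integral>p. supnorm T (fst p) \<partial>\<mu>) * (\<bar>b - b'\<bar> + \<bar>a - a'\<bar>)"
proof -
  let ?l = "min y y'" and ?u = "max y y'" and ?c = "\<bar>b - b'\<bar> + \<bar>a - a'\<bar>"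
  have lu: "0 \<le> ?l" "?l \<le> ?u" "?u \<le> 1" using D by (auto simp: Delta_iff)
  have ab: "a \<in> {0..T}" "b \<in> {0..T}" "a' \<in> {0..T}" "b' \<in> {0..T}" using D by (auto simp: Delta_iff)
  have i: "integrable \<mu> (\<lambda>p. indicator {y..<1} (snd p) * Q \<theta> a b p)"
    "integrable \<mu> (\<lambda>p. indicator {y'..<1} (snd p) * Q \<theta> a' b' p)"
    using D by (auto intro!: H_integrable \<theta> simp: Delta_iff)
  have "\<bar>H \<theta> y a b - H \<theta> y' a' b'\<bar> =
      \<bar>\<integral>p. indicator {y..<1} (snd p) * Q \<theta> a b p - indicator {y'..<1} (snd p) * Q \<theta> a' b' p \<partial>\<mu>\<bar>"
    unfolding H_def by (subst Bochner_Integration.integral_diff[OF i]) simp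
  also have "\<dots> \<le> (\<integral>p. \<bar>indicator {y..<1} (snd p) * Q \<theta> a b p - indicator {y'..<1} (snd p) * Q \<theta> a' b' p\<bar> \<partial>\<mu>)"
    by (rule integral_abs_bound)
  also have "\<dots> \<le> (\<integral>p. indicator {?l..<?u} (snd p) + supnorm T (fst p) * ?c \<partial>\<mu>)"
  proof (intro Bochner_Integration.integral_mono integrable_abs Bochner_Integration.integrable_diff i
      Bochner_Integration.integrable_add strip_integral lu integrable_mult_left supnorm_integrable)
    fix p assume p: "p \<in> space \<mu>"
    have "0 \<le> supnorm T (fst p) * ?c"
      using supnorm_nonneg p by (intro mult_nonneg_nonneg) (auto simp: space_\<mu>)
    then show "\<bar>indicator {y..<1} (snd p) * Q \<theta> a b p - indicator {y'..<1} (snd p) * Q \<theta> a' b' p\<bar>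
        \<le> indicator {?l..<?u} (snd p) + supnorm T (fst p) * ?c"
      using Q_diff[OF \<theta> p ab] Q_range[OF \<theta> p, of a b] Q_range[OF \<theta> p, of a' b']
      by (auto simp: indicator_def min_def max_def)
  qed
  also have "\<dots> = (?u - ?l) + (\<integral>p. supnorm T (fst p) \<partial>\<mu>) * ?c"
    using strip_integral[OF lu] supnorm_integrable
    by (subst Bochner_Integration.integral_add) auto
  also have "?u - ?l = \<bar>y - y'\<bar>" by auto
  finally show ?thesis .
qed

lemma Gmap_Theta:
  assumes \<theta>: "\<theta> \<in> Theta T"
  shows "Gmap T lam \<sigma> \<Omega> N \<theta> \<in> Theta T"
proof (rule ThetaI)
  let ?G = "Gmap T lam \<sigma> \<Omega> N \<theta>"
  define M where "M = (\<integral>p. supnorm T (fst p) \<partial>\<mu>)"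
  have M: "0 \<le> M"
    unfolding M_def using supnorm_nonneg by (intro Bochner_Integration.integral_nonneg) (auto simp: space_\<mu>)
  \<comment> \<open>Each coordinate distance is at most the distance of the points: the position
    contributes 1 and each of the two times contributes \<open>M\<close>.\<close>
  have "(1 + 2 * M)-lipschitz_on (Delta T) (\<lambda>(\<gamma>, t). ?G \<gamma> t)"
  proof (rule lipschitz_onI)
    fix p q assume pq: "p \<in> Delta T" "q \<in> Delta T"
    obtain y a b where [simp]: "p = ((y, a), b)" by (cases p) auto
    obtain y' a' b' where [simp]: "q = ((y', a'), b')" by (cases q) auto
    have "dist (fst p) (fst q) \<le> dist p q" "dist (snd p) (snd q) \<le> dist p q"
      by (rule dist_fst_le dist_snd_le)+
    moreover have "dist (fst (fst p)) (fst (fst q)) \<le> dist (fst p) (fst q)"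
      "dist (snd (fst p)) (snd (fst q)) \<le> dist (fst p) (fst q)"
      by (rule dist_fst_le dist_snd_le)+
    ultimately have d: "\<bar>y - y'\<bar> \<le> dist p q" "\<bar>a - a'\<bar> \<le> dist p q" "\<bar>b - b'\<bar> \<le> dist p q"
      by (simp_all add: dist_real_def)
    have "\<bar>H \<theta> y a b - H \<theta> y' a' b'\<bar> \<le> \<bar>y - y'\<bar> + M * (\<bar>b - b'\<bar> + \<bar>a - a'\<bar>)"
      unfolding M_def using H_Lipschitz[OF \<theta>] pq by simp
    also have "\<dots> \<le> dist p q + M * (dist p q + dist p q)"
      using d M by (intro add_mono mult_left_mono) auto
    finally have "\<bar>H \<theta> y a b - H \<theta> y' a' b'\<bar> \<le> (1 + 2 * M) * dist p q" by (simp add: algebra_simps)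
    then show "dist (case p of (\<gamma>, t) \<Rightarrow> ?G \<gamma> t) (case q of (\<gamma>, t) \<Rightarrow> ?G \<gamma> t) \<le> (1 + 2 * M) * dist p q"
      using pq by (simp add: Gmap_H dist_real_def abs_minus_commute)
  qed (use M in simp)
  then show "continuous_on (Delta T) (\<lambda>(\<gamma>, t). ?G \<gamma> t)"
    by (rule lipschitz_on_continuous_on)
  show "0 \<le> ?G \<gamma> t \<and> ?G \<gamma> t \<le> 1" if "(\<gamma>, t) \<in> Delta T" for \<gamma> t
    using that H_range[OF \<theta>] by (cases \<gamma>) (auto simp: Gmap_H Delta_iff)
  show "?G (y0, t0) t0 = y0" if "((y0, t0), t0) \<in> Delta T" for y0 t0
    using that H_refl[OF \<theta>] by (auto simp: Gmap_H Delta_iff)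
  show "?G (z, 0) t \<le> ?G (y, 0) t" if "0 \<le> z" "z \<le> y" "y \<le> 1" "t \<in> {0..T}" for z y t
    using that H_mono[OF \<theta>, of 0 0 t t z y] by (simp add: Gmap_H Delta_iff)
  show "?G (0, r) t \<le> ?G (0, s) t" if "0 \<le> s" "s \<le> r" "r \<le> t" "t \<le> T" for s r t
    using that H_mono[OF \<theta>, of s r t t 0 0] by (simp add: Gmap_H Delta_iff)
  show "?G \<gamma> t \<le> ?G \<gamma> t'" if "(\<gamma>, t) \<in> Delta T" "(\<gamma>, t') \<in> Delta T" "t \<le> t'" for \<gamma> t t'
    using that H_mono[OF \<theta>, of "snd \<gamma>" "snd \<gamma>" t t' "fst \<gamma>" "fst \<gamma>"] by (cases \<gamma>) (simp add: Gmap_H Delta_iff)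
  show "?G \<gamma> t = 0" if "(\<gamma>, t) \<notin> Delta T" for \<gamma> t
    using that by (simp add: Gmap_def)
qed (use T_pos in simp)

text \<open>\<open>Q_diff_flow\<close> yields
  \<open>2 * (C * m) * (exp (\<beta> * t) - 1) / \<beta>\<close>; the exponent is chosen so that
  \<open>2 * C\<close> is at most half of it, and the summand 1 keeps it positive when
  \<open>C = 0\<close>. Carrying a pointwise bound \<open>m\<close> avoids forming a weighted
  supremum.\<close>

lemma Gmap_contraction:
  assumes \<theta>: "\<theta> \<in> Theta T" "\<theta>' \<in> Theta T" and m: "0 \<le> m"
    and le: "\<And>\<gamma> u. (\<gamma>, u) \<in> Delta T \<Longrightarrow> \<bar>\<theta> \<gamma> u - \<theta>' \<gamma> u\<bar> \<le> m * exp ((4 * C + 1) * u)"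
    and D: "(\<gamma>, t) \<in> Delta T"
  shows "\<bar>Gmap T lam \<sigma> \<Omega> N \<theta> \<gamma> t - Gmap T lam \<sigma> \<Omega> N \<theta>' \<gamma> t\<bar> \<le> m / 2 * exp ((4 * C + 1) * t)"
proof -
  obtain y t0 where [simp]: "\<gamma> = (y, t0)" by (cases \<gamma>)
  have t: "0 \<le> t0" "t0 \<le> t" "t \<le> T" using D by (auto simp: Delta_iff)
  let ?\<beta> = "4 * C + 1"
  define c where "c = 2 * (C * m) * (exp (?\<beta> * t) - 1) / ?\<beta>"
  have \<beta>: "0 < ?\<beta>" using C_nonneg by simp
  have c0: "0 \<le> c" unfolding c_def using C_nonneg m t by (intro divide_nonneg_pos mult_nonneg_nonneg) auto
  note i = H_integrable[OF \<theta>(1) t, of y] H_integrable[OF \<theta>(2) t, of y]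
  have "\<bar>H \<theta> y t0 t - H \<theta>' y t0 t\<bar> =
      \<bar>\<integral>p. indicator {y..<1} (snd p) * Q \<theta> t0 t p - indicator {y..<1} (snd p) * Q \<theta>' t0 t p \<partial>\<mu>\<bar>"
    unfolding H_def by (subst Bochner_Integration.integral_diff[OF i]) simp
  also have "\<dots> \<le> (\<integral>p. \<bar>indicator {y..<1} (snd p) * Q \<theta> t0 t p - indicator {y..<1} (snd p) * Q \<theta>' t0 t p\<bar> \<partial>\<mu>)"
    by (rule integral_abs_bound)
  also have "\<dots> \<le> (\<integral>p. c \<partial>\<mu>)"
  proof (intro Bochner_Integration.integral_mono integrable_abs Bochner_Integration.integrable_diff i)
    fix p assume p: "p \<in> space \<mu>"
    show "\<bar>indicator {y..<1} (snd p) * Q \<theta> t0 t p - indicator {y..<1} (snd p) * Q \<theta>' t0 t p\<bar> \<le> c"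
      using Q_diff_flow[OF \<theta> p t \<beta> m le] c0 by (auto simp: indicator_def c_def)
  qed simp
  also have "\<dots> = c" by (simp add: \<mu>.prob_space)
  also have "c \<le> m / 2 * exp (?\<beta> * t)"
  proof -
    have "2 * (C * m) * (exp (?\<beta> * t) - 1) \<le> (m / 2 * ?\<beta>) * exp (?\<beta> * t)"
      using mult_mono[of "2 * (C * m)" "m / 2 * ?\<beta>" "exp (?\<beta> * t) - 1" "exp (?\<beta> * t)"] C_nonneg m t
      by (simp add: algebra_simps)
    then show ?thesis unfolding c_def using \<beta> by (simp add: divide_le_eq mult_ac)
  qed
  finally show ?thesis using D by (simp add: Gmap_H abs_minus_commute)
qed

text \<open>Two flows differ by at most 1, and applying G to fixed points leaves them unchanged
  while halving the bound.\<close>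

lemma Gmap_fixed_point_unique:
  assumes y: "y \<in> Theta T" "y = Gmap T lam \<sigma> \<Omega> N y" and y': "y' \<in> Theta T" "y' = Gmap T lam \<sigma> \<Omega> N y'"
  shows "y = y'"
proof (intro ext)
  fix \<gamma> t
  have "\<bar>y \<gamma> t - y' \<gamma> t\<bar> \<le> (1 / 2) ^ n * exp ((4 * C + 1) * t)" if "(\<gamma>, t) \<in> Delta T" for \<gamma> t n
    using that
  proof (induction n arbitrary: \<gamma> t)
    case 0
    have "0 \<le> t" using 0 by (auto simp: Delta_def)
    then have "1 \<le> exp ((4 * C + 1) * t)" using C_nonneg by simp
    then show ?case unfolding power_0 mult_1_left abs_le_iff
      using Theta_range[OF y(1) 0] Theta_range[OF y'(1) 0] by linarith
  next
    case (Suc n)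
    have "\<bar>Gmap T lam \<sigma> \<Omega> N y \<gamma> t - Gmap T lam \<sigma> \<Omega> N y' \<gamma> t\<bar> \<le> (1 / 2) ^ n / 2 * exp ((4 * C + 1) * t)"
      using Suc by (intro Gmap_contraction y(1) y'(1)) auto
    then show ?case unfolding y(2)[symmetric] y'(2)[symmetric] by simp
  qed
  note le = this
  show "y \<gamma> t = y' \<gamma> t"
  proof (cases "(\<gamma>, t) \<in> Delta T")
    case True
    have "(\<lambda>n. (1 / 2) ^ n * exp ((4 * C + 1) * t)) \<longlonglongrightarrow> 0"
      by (intro tendsto_mult_left_zero LIMSEQ_power_zero) simp
    then have "\<bar>y \<gamma> t - y' \<gamma> t\<bar> \<le> 0" by (rule LIMSEQ_le_const) (use le[OF True] in auto)
    then show ?thesis by simp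
  next
    case False
    show ?thesis using Theta_outside[OF y(1) False] Theta_outside[OF y'(1) False] by simp
  qed
qed

lemma Gmap_fixed_point_exists: "\<exists>y. y \<in> Theta T \<and> y = Gmap T lam \<sigma> \<Omega> N y"
proof -
  let ?G = "Gmap T lam \<sigma> \<Omega> N" and ?\<beta> = "4 * C + 1"
  define F where "F n = (?G ^^ n) (\<lambda>\<gamma> t. if (\<gamma>, t) \<in> Delta T then fst \<gamma> else 0)" for n
  have F: "F n \<in> Theta T" for n
  proof (induction n)
    case 0
    show ?case unfolding F_def funpow_0 by (rule Theta_nonempty) (use T_pos in simp)
  next
    case (Suc n)
    then show ?case unfolding F_def funpow.simps o_apply by (rule Gmap_Theta)
  qed
  have F_Suc: "F (Suc n) = ?G (F n)" for n
    unfolding F_def funpow.simps o_apply ..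
  have t0: "0 \<le> t" "t \<le> T" if "(\<gamma>, t) \<in> Delta T" for \<gamma> t using that by (auto simp: Delta_def)
  have step: "\<bar>F (Suc n) \<gamma> t - F n \<gamma> t\<bar> \<le> (1 / 2) ^ n * exp (?\<beta> * t)" if "(\<gamma>, t) \<in> Delta T" for \<gamma> t n
    using that
  proof (induction n arbitrary: \<gamma> t)
    case 0
    have "1 \<le> exp (?\<beta> * t)" using C_nonneg t0[OF 0] by simp
    then show ?case unfolding power_0 mult_1_left abs_le_iff
      using Theta_range[OF F 0, of 0] Theta_range[OF F 0, of "Suc 0"] by linarith
  next
    case (Suc n)
    have "\<bar>?G (F (Suc n)) \<gamma> t - ?G (F n) \<gamma> t\<bar> \<le> (1 / 2) ^ n / 2 * exp (?\<beta> * t)"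
      using Suc by (intro Gmap_contraction F) auto
    then show ?case by (simp add: F_Suc)
  qed
  \<comment> \<open>The limit is written as a telescoping series, so that geometric majorants of the
    increments give uniform convergence by the Weierstrass test.\<close>
  define y where "y \<gamma> t = F 0 \<gamma> t + (\<Sum>n. F (Suc n) \<gamma> t - F n \<gamma> t)" for \<gamma> t
  have "uniform_limit (Delta T) (\<lambda>n (\<gamma>, t). \<Sum>i<n. F (Suc i) \<gamma> t - F i \<gamma> t)
      (\<lambda>(\<gamma>, t). \<Sum>n. F (Suc n) \<gamma> t - F n \<gamma> t) sequentially"
    unfolding case_prod_beta'
  proof (rule Weierstrass_m_test)
    show "summable (\<lambda>n. (1 / 2) ^ n * exp (?\<beta> * T))"
      by (intro summable_mult2 summable_geometric) simp
    fix n p assume p: "p \<in> Delta T"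
    have pD: "(fst p, snd p) \<in> Delta T" using p by simp
    have "(1 / 2) ^ n * exp (?\<beta> * snd p) \<le> (1 / 2) ^ n * exp (?\<beta> * T)"
      using t0[OF pD] C_nonneg by (intro mult_left_mono) (auto intro: mult_left_mono)
    with step[OF pD, of n]
    show "norm (F (Suc n) (fst p) (snd p) - F n (fst p) (snd p)) \<le> (1 / 2) ^ n * exp (?\<beta> * T)"
      unfolding real_norm_def by (rule order_trans)
  qed
  then have sum_lim: "uniform_limit (Delta T)
      (\<lambda>n p. (case p of (\<gamma>, t) \<Rightarrow> F 0 \<gamma> t) + (case p of (\<gamma>, t) \<Rightarrow> \<Sum>i<n. F (Suc i) \<gamma> t - F i \<gamma> t))
      (\<lambda>p. (case p of (\<gamma>, t) \<Rightarrow> F 0 \<gamma> t) + (case p of (\<gamma>, t) \<Rightarrow> \<Sum>n. F (Suc n) \<gamma> t - F n \<gamma> t)) sequentially"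
    by (rule uniform_limit_add[OF uniform_limit_const])
  have lim: "uniform_limit (Delta T) (\<lambda>n (\<gamma>, t). F n \<gamma> t) (\<lambda>(\<gamma>, t). y \<gamma> t) sequentially"
  proof -
    have partial_sums: "(\<lambda>n p. (case p of (\<gamma>, t) \<Rightarrow> F 0 \<gamma> t) + (case p of (\<gamma>, t) \<Rightarrow> \<Sum>i<n. F (Suc i) \<gamma> t - F i \<gamma> t))
      = (\<lambda>n (\<gamma>, t). F n \<gamma> t)"
    proof (intro ext)
      fix n :: nat and p :: "(real \<times> real) \<times> real"
      obtain \<gamma> t where p: "p = (\<gamma>, t)" by (cases p)
      show "(case p of (\<gamma>, t) \<Rightarrow> F 0 \<gamma> t) + (case p of (\<gamma>, t) \<Rightarrow> \<Sum>i<n. F (Suc i) \<gamma> t - F i \<gamma> t)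
        = (case p of (\<gamma>, t) \<Rightarrow> F n \<gamma> t)"
        unfolding p prod.case using sum_lessThan_telescope[of "\<lambda>i. F i \<gamma> t" n] by linarith
    qed
    have sums: "(\<lambda>p. (case p of (\<gamma>, t) \<Rightarrow> F 0 \<gamma> t) + (case p of (\<gamma>, t) \<Rightarrow> \<Sum>n. F (Suc n) \<gamma> t - F n \<gamma> t))
      = (\<lambda>(\<gamma>, t). y \<gamma> t)"
      by (simp add: fun_eq_iff y_def)
    show ?thesis using sum_lim unfolding partial_sums sums .
  qed
  have y: "y \<in> Theta T"
  proof (rule Theta_uniform_limit[OF _ F lim])
    show "y \<gamma> t = 0" if "(\<gamma>, t) \<notin> Delta T" for \<gamma> t
      unfolding y_def Theta_outside[OF F that] by simp
  qed (use T_pos in simp)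
  have "y \<gamma> t = ?G y \<gamma> t" for \<gamma> t
  proof (cases "(\<gamma>, t) \<in> Delta T")
    case True
    have "(\<lambda>n. F (Suc n) \<gamma> t) \<longlonglongrightarrow> y \<gamma> t"
      using LIMSEQ_Suc[OF tendsto_uniform_limitI[OF lim True]] by simp
    moreover have "(\<lambda>n. F (Suc n) \<gamma> t) \<longlonglongrightarrow> ?G y \<gamma> t"
    proof (rule LIMSEQ_I)
      fix e :: real assume e: "0 < e"
      \<comment> \<open>With this tolerance the contraction gives a bound \<open>e / 2\<close> at
        the given time \<open>t\<close>.\<close>
      define m where "m = e / exp (?\<beta> * t)"
      have m: "0 < m" using e by (simp add: m_def)
      from uniform_limitD[OF lim m] obtain n0 where n0: "\<forall>n\<ge>n0. \<forall>p\<in>Delta T.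
          dist (case p of (\<gamma>, t) \<Rightarrow> F n \<gamma> t) (case p of (\<gamma>, t) \<Rightarrow> y \<gamma> t) < m"
        unfolding eventually_sequentially by (rule exE)
      have "norm (F (Suc n) \<gamma> t - ?G y \<gamma> t) < e" if n: "n0 \<le> n" for n
      proof -
        have "\<bar>?G (F n) \<gamma> t - ?G y \<gamma> t\<bar> \<le> m / 2 * exp (?\<beta> * t)"
        proof (rule Gmap_contraction[OF F y _ _ True])
          fix \<gamma> u assume D: "(\<gamma>, u) \<in> Delta T"
          have "m * 1 \<le> m * exp (?\<beta> * u)" using m t0[OF D] C_nonneg by (intro mult_left_mono) auto
          then show "\<bar>F n \<gamma> u - y \<gamma> u\<bar> \<le> m * exp (?\<beta> * u)" using n0[rule_format, OF n D] by (simp add: dist_real_def)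
        qed (use m in simp)
        also have "\<dots> < e" using e by (simp add: m_def)
        finally show ?thesis by (simp add: F_Suc)
      qed
      then show "\<exists>no. \<forall>n\<ge>no. norm (F (Suc n) \<gamma> t - ?G y \<gamma> t) < e"
        by (intro exI[of _ n0] allI impI)
    qed
    ultimately show ?thesis by (rule LIMSEQ_unique)
  next
    case False
    then show ?thesis using Theta_outside[OF y False] by (simp add: Gmap_def)
  qed
  with y show ?thesis by blast
qed

end

theorem theorem5p1:
  fixes T :: real and W :: "rfun set" and lam :: "rfun measure"
    and \<sigma> :: "rfun \<Rightarrow> real \<Rightarrow> real"
    and \<Omega> :: "(real \<times> real \<Rightarrow> real \<Rightarrow> real) \<Rightarrow> rfun \<Rightarrow> real \<Rightarrow> 'a measure"
    and N :: "(real \<times> real \<Rightarrow> real \<Rightarrow> real) \<Rightarrow> rfun \<Rightarrow> real \<Rightarrow> 'a \<Rightarrow> real \<Rightarrow> nat"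
  assumes T_pos: "T > 0"
    and W_C1: "\<forall>w\<in>W. C1_rect T w \<and> (\<forall>p\<in>rect T. 0 \<le> w p)"
    and lam_prob: "prob_space lam"
    and lam_space: "space lam = W"
    and lam_sets: "sets lam = borel_supnorm T W"
    and M_W: "(\<integral>\<^sup>+ w. ennreal (supnorm T w) \<partial>lam) < \<infinity>"
    and C_W: "\<exists>C. \<forall>w\<in>W. \<forall>p\<in>rect T. \<bar>partial_y w p\<bar> \<le> C"
    and \<sigma>_meas: "(\<lambda>(w, z). \<sigma> w z) \<in> borel_measurable (lam \<Otimes>\<^sub>M restrict_space lborel {0..1})"
    and \<sigma>_nonneg: "\<forall>w\<in>W. \<forall>z\<in>{0..1}. 0 \<le> \<sigma> w z"
    and mu0_prob: "prob_space (mu0 lam \<sigma>)"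
    and \<sigma>_int_w: "\<forall>y\<in>{0..1}. (\<integral>w. \<sigma> w y \<partial>lam) = 1"
    and \<sigma>_int_z: "\<forall>w\<in>W. (LBINT z:{0..1}. \<sigma> w z) = 1"
    and N_pp: "\<forall>\<theta>\<in>Theta T. \<forall>w\<in>W. \<forall>z\<in>{0..<1}.
                 point_process T (\<Omega> \<theta> w z) (N \<theta> w z) (omega \<theta> w z)"
  shows "\<exists>!y. y \<in> Theta T \<and> y = Gmap T lam \<sigma> \<Omega> N y"
proof -
  obtain C where C: "\<And>w p. w \<in> W \<Longrightarrow> p \<in> rect T \<Longrightarrow> \<bar>partial_y w p\<bar> \<le> C"
    using C_W by blast
  \<comment> \<open>The bound obtained from the hypothesis carries no sign information; its absolute
    value is a nonnegative bound.\<close>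
  interpret flow_model T "\<bar>C\<bar>" W lam \<sigma> \<Omega> N
  proof (rule flow_model.intro)
    show "0 \<le> \<bar>C\<bar>" by simp
    show "\<bar>partial_y w p\<bar> \<le> \<bar>C\<bar>" if "w \<in> W" "p \<in> rect T" for w p
      using C[OF that] by linarith
    show "C1_rect T w" if "w \<in> W" for w
      using W_C1 that by blast
    show "0 \<le> w p" if "w \<in> W" "p \<in> rect T" for w p
      using W_C1 that by blast
    show "0 \<le> \<sigma> w z" if "w \<in> W" "z \<in> {0..1}" for w z
      using \<sigma>_nonneg that by blast
    show "(\<integral>w. \<sigma> w y \<partial>lam) = 1" if "y \<in> {0..1}" for y
      using \<sigma>_int_w that by blast
    show "(LBINT z:{0..1}. \<sigma> w z) = 1" if "w \<in> W" for w
      using \<sigma>_int_z that by blast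
    show "point_process T (\<Omega> \<theta> w z) (N \<theta> w z) (omega \<theta> w z)"
      if "\<theta> \<in> Theta T" "w \<in> W" "z \<in> {0..<1}" for \<theta> w z
      using N_pp that by blast
  qed fact+
  show ?thesis
  proof (rule ex_ex1I)
    show "\<exists>y. y \<in> Theta T \<and> y = Gmap T lam \<sigma> \<Omega> N y" by (rule Gmap_fixed_point_exists)
    fix y y' assume "y \<in> Theta T \<and> y = Gmap T lam \<sigma> \<Omega> N y" "y' \<in> Theta T \<and> y' = Gmap T lam \<sigma> \<Omega> N y'"
    then show "y = y'" by (elim conjE) (rule Gmap_fixed_point_unique)
  qed
qed

end
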